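(* Consider the $JK$-user coordinated multicell downlink described in the context, with given channel vectors $\mathbf{h}_{n,m}\in\mathbb{C}^{N\times 1}$, weights $\mathbf{w}\in\mathbb{R}_{++}^{JK}$, priorities $\boldsymbol{\beta}\in\mathbb{R}_{++}^{JK}$, noise powers $\boldsymbol{\sigma}\in\mathbb{R}_{++}^{JK}$ and power budget $\bar P>0$. Let $\mathbb{U}^*$, $\mathbf{p}^*$, $\mathbf{q}^*$ be the optimal beamforming matrix, optimal primal power and optimal dual power defined in the context. Starting from any initial point $\mathbf{q}[0]\in\mathbb{R}_{++}^{JK}$, $\mathbf{p}[0]\in\mathbb{R}_{++}^{JK}$, $\mathbb{U}[0]=(\mathbf{u}_1[0],\dots,\mathbf{u}_{JK}[0])$ with $\|\mathbf{u}_m[0]\|=1$ for all $m$, $\frac1N\mathbf{w}^{\mathsf T}\mathbf{p}[0]\le\bar P$ and $\frac1N\boldsymbol{\sigma}^{\mathsf T}\mathbf{q}[0]\le\bar P$, define for $\kappa=0,1,2,\dots$ (all updates for every $m=1,\dots,JK$): 1. $q_m[\kappa+1]=\dfrac{\beta_m}{\Gamma_m^{\mathsf{DN}}(\mathbf{q}[\kappa],\mathbb{U}[\kappa])}\,q_m[\kappa]$; 2. replace $\mathbf{q}[\kappa+1]$ by $\dfrac{N\bar P}{\boldsymbol{\sigma}^{\mathsf T}\mathbf{q}[\kappa+1]}\,\mathbf{q}[\kappa+1]$; 3. $\mathbf{u}_m[\kappa+1]=\dfrac{\mathbf{v}_m}{\|\mathbf{v}_m\|}$, where $\mathbf{v}_m=\Big(\sum_{n\ne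 m}\frac{q_n[\kappa+1]}{N}\mathbf{h}_{m,n}\mathbf{h}_{m,n}^{\dagger}+w_m\mathbf{I}\Big)^{-1}\mathbf{h}_{m,m}$; 4. $p_m[\kappa+1]=\dfrac{\beta_m}{\Gamma_m^{\mathsf{PN}}(\mathbf{p}[\kappa],\mathbb{U}[\kappa+1])}\,p_m[\kappa]$; 5. replace $\mathbf{p}[\kappa+1]$ by $\dfrac{N\bar P}{\mathbf{w}^{\mathsf T}\mathbf{p}[\kappa+1]}\,\mathbf{p}[\kappa+1]$. Then $\mathbf{q}[\kappa]$, $\mathbf{p}[\kappa]$ and $\mathbb{U}[\kappa]$ converge geometrically fast, as $\kappa\to\infty$, to $\mathbf{q}^*$, $\mathbf{p}^*$ and $\mathbb{U}^*$ respectively.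
   Context: There are $J$ base stations, each with $N$ transmit antennas and serving $K$ single-antenna users. Users (equivalently, streams) are indexed by $m=1,\dots,JK$, where $m=(j-1)K+k$ stands for user $k$ in cell $j$. $\mathbf{h}_{n,m}\in\mathbb{C}^{N\times1}$ is the channel vector from the base station that serves user $n$ to user $m$; thus $\mathbf{h}_{n,m}$ depends on $n$ only through the cell of $n$. $\mathbb{U}=(\mathbf{u}_1,\dots,\mathbf{u}_{JK})$ is a beamforming matrix whose columns satisfy $\|\mathbf{u}_m\|=1$. Put $G_{m,n}(\mathbb{U})=|\mathbf{h}_{n,m}^{\dagger}\mathbf{u}_n|^2$; it is a standing assumption that $G_{m,n}(\mathbb{U})>0$ for all $m,n$ for the beamforming matrices that occur. $\mathbb{R}_{++}$ denotes the positive reals. For $\mathbf{p},\mathbf{q}\in\mathbb{R}_{++}^{JK}$ the primal (downlink) and dual (uplink) signal-to-interference-plus-noise ratios are $$\Gamma_m^{\mathsf{PN}}(\mathbf{p},\mathbb{U})=\frac{\frac{p_m}{N}|\mathbf{h}_{m,m}^{\dagger}\mathbf{u}_m|^2}{\sum_{n\ne m}\frac{p_n}{N}|\mathbf{h}_{n,m}^{\dagger}\mathbf{u}_n|^2+\sigma_m},\qquad \Gamma_m^{\mathsf{DN}}(\mathbf{q},\mathbb{U})=\frac{\frac{q_m}{N}|\mathbf{h}_{m,m}^{\dagger}\mathbf{u}_m|^2}{\sum_{n\ne m}\frac{q_n}{N}|\mathbf{h}_{m,n}^{\dagger}\mathbf{u}_m|^2+w_m}.$$ Primal problem: maximize $\min_m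 \Gamma_m^{\mathsf{PN}}(\mathbf{p},\mathbb{U})/\beta_m$ over $\mathbf{p}>0$ and $\mathbb{U}$ with $\|\mathbf{u}_m\|=1$ for all $m$, subject to $\frac1N\mathbf{w}^{\mathsf T}\mathbf{p}\le\bar P$. Dual problem: maximize $\min_m \Gamma_m^{\mathsf{DN}}(\mathbf{q},\mathbb{U})/\beta_m$ over $\mathbf{q}>0$ and $\mathbb{U}$ with $\|\mathbf{u}_m\|=1$ for all $m$, subject to $\frac1N\boldsymbol{\sigma}^{\mathsf T}\mathbf{q}\le\bar P$. For a fixed $\mathbb{U}$, $\mathbf{p}^*(\mathbb{U})$ and $\mathbf{q}^*(\mathbb{U})$ denote the optimal powers of the primal and dual problem with $\mathbb{U}$ held fixed. For a fixed $\mathbf{q}$, the optimal beamformer (minimum variance distortionless response) is $$\mathbf{u}_m^*(\mathbf{q})=\frac{\big(\sum_{n\ne m}\frac{q_n}{N}\mathbf{h}_{m,n}\mathbf{h}_{m,n}^{\dagger}+w_m\mathbf{I}\big)^{-1}\mathbf{h}_{m,m}}{\big\|\big(\sum_{n\ne m}\frac{q_n}{N}\mathbf{h}_{m,n}\mathbf{h}_{m,n}^{\dagger}+w_m\mathbf{I}\big)^{-1}\mathbf{h}_{m,m}\big\|}.$$ The optimal solution is the triple $(\mathbf{q}^*,\mathbf{p}^*,\mathbb{U}^* )$ with $\mathbf{u}_m^*=\mathbf{u}_m^*(\mathbf{q}^* )$ for all $m$, $\mathbf{q}^*=\mathbf{q}^*(\mathbb{U}^* )$, $\mathbf{p}^*=\mathbf{p}^*(\mathbb{U}^*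 )$; that is, $(\mathbf{q}^*,\mathbb{U}^* )$ solves the dual problem and $(\mathbf{p}^*,\mathbb{U}^* )$ solves the primal problem (the phase ambiguity of the beamformers being fixed by the displayed formula). A sequence $x[\kappa]$ converges geometrically fast to $x^*$ if there are constants $C>0$ and $r\in(0,1)$ with $\|x[\kappa]-x^*\|\le C r^{\kappa}$ for all $\kappa$. *)

theory Defs
  imports "HOL-Analysis.Analysis"
begin

text \<open>
  The types \<open>'j\<close>, \<open>'k\<close> and \<open>'n\<close> index the base stations, the users of one cell and the antennas of
  one base station, so that \<open>J = CARD('j)\<close>, \<open>K = CARD('k)\<close> and \<open>N = CARD('n)\<close>.  A user is a pair
  (cell, position in the cell).  The channels are given as \<open>H j m\<close>, from base station \<open>j\<close> to user
  \<open>m\<close>.  A beamforming matrix is represented by the vector of its columns: \<open>U $ m\<close> is the beamformer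
  of user \<open>m\<close>, and the norm of \<open>U\<close> is the Frobenius norm.
\<close>

type_synonym ('n, 'j, 'k) channels = "'j \<Rightarrow> 'j \<times> 'k \<Rightarrow> complex ^ 'n"
type_synonym ('j, 'k) powers = "real ^ ('j \<times> 'k)"
type_synonym ('n, 'j, 'k) beams = "complex ^ 'n ^ ('j \<times> 'k)"

definition chan :: "('n::finite, 'j, 'k) channels \<Rightarrow> 'j \<times> 'k \<Rightarrow> 'j \<times> 'k \<Rightarrow> complex ^ 'n" where
  "chan H n m = H (fst n) m"

definition herm_prod :: "complex ^ 'n \<Rightarrow> complex ^ 'n \<Rightarrow> complex" where
  "herm_prod x y = (\<Sum>i\<in>UNIV. cnj (x $ i) * y $ i)"

definition herm_outer :: "complex ^ 'n \<Rightarrow> complex ^ 'n ^ 'n" where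
  "herm_outer x = (\<chi> i j. x $ i * cnj (x $ j))"

definition gain ::
  "('n::finite, 'j::finite, 'k::finite) channels \<Rightarrow> ('n, 'j, 'k) beams \<Rightarrow> 'j \<times> 'k \<Rightarrow> 'j \<times> 'k \<Rightarrow> real"
  where "gain H U m n = (cmod (herm_prod (chan H n m) (U $ n)))\<^sup>2"

definition sinr_primal ::
  "('n::finite, 'j::finite, 'k::finite) channels \<Rightarrow> ('j, 'k) powers \<Rightarrow> ('j, 'k) powers
     \<Rightarrow> ('n, 'j, 'k) beams \<Rightarrow> 'j \<times> 'k \<Rightarrow> real"
  where
  "sinr_primal H \<sigma> p U m =
     (p $ m / CARD('n) * (cmod (herm_prod (chan H m m) (U $ m)))\<^sup>2) /
     ((\<Sum>n\<in>UNIV - {m}. p $ n / CARD('n) * (cmod (herm_prod (chan H n m) (U $ n)))\<^sup>2) + \<sigma> $ m)"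

definition sinr_dual ::
  "('n::finite, 'j::finite, 'k::finite) channels \<Rightarrow> ('j, 'k) powers \<Rightarrow> ('j, 'k) powers
     \<Rightarrow> ('n, 'j, 'k) beams \<Rightarrow> 'j \<times> 'k \<Rightarrow> real"
  where
  "sinr_dual H w q U m =
     (q $ m / CARD('n) * (cmod (herm_prod (chan H m m) (U $ m)))\<^sup>2) /
     ((\<Sum>n\<in>UNIV - {m}. q $ n / CARD('n) * (cmod (herm_prod (chan H m n) (U $ m)))\<^sup>2) + w $ m)"

definition positive_vec :: "real ^ 'i \<Rightarrow> bool" where
  "positive_vec x \<longleftrightarrow> (\<forall>i. 0 < x $ i)"

definition unit_beams :: "('n::finite, 'j::finite, 'k::finite) beams \<Rightarrow> bool" where
  "unit_beams U \<longleftrightarrow> (\<forall>m. norm (U $ m) = 1)"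

definition primal_objective ::
  "('n::finite, 'j::finite, 'k::finite) channels \<Rightarrow> ('j, 'k) powers \<Rightarrow> ('j, 'k) powers
     \<Rightarrow> ('j, 'k) powers \<Rightarrow> ('n, 'j, 'k) beams \<Rightarrow> real"
  where "primal_objective H \<beta> \<sigma> p U = (MIN m. sinr_primal H \<sigma> p U m / \<beta> $ m)"

definition dual_objective ::
  "('n::finite, 'j::finite, 'k::finite) channels \<Rightarrow> ('j, 'k) powers \<Rightarrow> ('j, 'k) powers
     \<Rightarrow> ('j, 'k) powers \<Rightarrow> ('n, 'j, 'k) beams \<Rightarrow> real"
  where "dual_objective H \<beta> w q U = (MIN m. sinr_dual H w q U m / \<beta> $ m)"

text \<open>
  The power constraint with \<open>N\<close> antennas.  The primal problem uses the weight \<open>w\<close>, the dual problem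
  the weight \<open>\<sigma>\<close>.
\<close>

definition feasible_power ::
  "nat \<Rightarrow> ('j::finite, 'k::finite) powers \<Rightarrow> real \<Rightarrow> ('j, 'k) powers \<Rightarrow> bool"
  where "feasible_power N c P x \<longleftrightarrow> positive_vec x \<and> 1 / N * (c \<bullet> x) \<le> P"

definition solves_primal ::
  "('n::finite, 'j::finite, 'k::finite) channels \<Rightarrow> ('j, 'k) powers \<Rightarrow> ('j, 'k) powers
     \<Rightarrow> ('j, 'k) powers \<Rightarrow> real \<Rightarrow> ('j, 'k) powers \<Rightarrow> ('n, 'j, 'k) beams \<Rightarrow> bool"
  where
  "solves_primal H w \<beta> \<sigma> P p U \<longleftrightarrow>
     is_arg_max (\<lambda>(p, U). primal_objective H \<beta> \<sigma> p U)
       (\<lambda>(p, U). feasible_power CARD('n) w P p \<and> unit_beams U) (p, U)"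

definition solves_dual ::
  "('n::finite, 'j::finite, 'k::finite) channels \<Rightarrow> ('j, 'k) powers \<Rightarrow> ('j, 'k) powers
     \<Rightarrow> ('j, 'k) powers \<Rightarrow> real \<Rightarrow> ('j, 'k) powers \<Rightarrow> ('n, 'j, 'k) beams \<Rightarrow> bool"
  where
  "solves_dual H w \<beta> \<sigma> P q U \<longleftrightarrow>
     is_arg_max (\<lambda>(q, U). dual_objective H \<beta> w q U)
       (\<lambda>(q, U). feasible_power CARD('n) \<sigma> P q \<and> unit_beams U) (q, U)"

definition primal_power_opt ::
  "('n::finite, 'j::finite, 'k::finite) channels \<Rightarrow> ('j, 'k) powers \<Rightarrow> ('j, 'k) powers
     \<Rightarrow> ('j, 'k) powers \<Rightarrow> real \<Rightarrow> ('n, 'j, 'k) beams \<Rightarrow> ('j, 'k) powers \<Rightarrow> bool"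
  where
  "primal_power_opt H w \<beta> \<sigma> P U p \<longleftrightarrow>
     is_arg_max (\<lambda>p. primal_objective H \<beta> \<sigma> p U) (feasible_power CARD('n) w P) p"

definition dual_power_opt ::
  "('n::finite, 'j::finite, 'k::finite) channels \<Rightarrow> ('j, 'k) powers \<Rightarrow> ('j, 'k) powers
     \<Rightarrow> ('j, 'k) powers \<Rightarrow> real \<Rightarrow> ('n, 'j, 'k) beams \<Rightarrow> ('j, 'k) powers \<Rightarrow> bool"
  where
  "dual_power_opt H w \<beta> \<sigma> P U q \<longleftrightarrow>
     is_arg_max (\<lambda>q. dual_objective H \<beta> w q U) (feasible_power CARD('n) \<sigma> P) q"

text \<open>MVDR: minimum variance distortionless response.\<close>

definition mvdr_matrix ::
  "('n::finite, 'j::finite, 'k::finite) channels \<Rightarrow> ('j, 'k) powers \<Rightarrow> ('j, 'k) powers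
     \<Rightarrow> 'j \<times> 'k \<Rightarrow> complex ^ 'n ^ 'n"
  where
  "mvdr_matrix H w q m =
     (\<Sum>n\<in>UNIV - {m}. (q $ n / CARD('n)) *\<^sub>R herm_outer (chan H m n)) + (w $ m) *\<^sub>R mat 1"

definition mvdr ::
  "('n::finite, 'j::finite, 'k::finite) channels \<Rightarrow> ('j, 'k) powers \<Rightarrow> ('j, 'k) powers
     \<Rightarrow> ('n, 'j, 'k) beams"
  where
  "mvdr H w q = (\<chi> m. let v = matrix_inv (mvdr_matrix H w q m) *v chan H m m in v /\<^sub>R norm v)"

text \<open>
  An optimal solution \<open>(q, p, U)\<close>.  Optimality of the powers for fixed \<open>U\<close> already follows from the
  joint optimality in the last two conjuncts; the equation for \<open>U\<close> fixes the phases of the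
  beamformers.
\<close>

definition optimal_solution ::
  "('n::finite, 'j::finite, 'k::finite) channels \<Rightarrow> ('j, 'k) powers \<Rightarrow> ('j, 'k) powers
     \<Rightarrow> ('j, 'k) powers \<Rightarrow> real
     \<Rightarrow> ('j, 'k) powers \<times> ('j, 'k) powers \<times> ('n, 'j, 'k) beams \<Rightarrow> bool"
  where
  "optimal_solution H w \<beta> \<sigma> P = (\<lambda>(q, p, U).
     U = mvdr H w q \<and> dual_power_opt H w \<beta> \<sigma> P U q \<and> primal_power_opt H w \<beta> \<sigma> P U p \<and>
     solves_dual H w \<beta> \<sigma> P q U \<and> solves_primal H w \<beta> \<sigma> P p U)"

definition normalize_power ::
  "nat \<Rightarrow> ('j::finite, 'k::finite) powers \<Rightarrow> real \<Rightarrow> ('j, 'k) powers \<Rightarrow> ('j, 'k) powers"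
  where "normalize_power N c P x = (N * P / (c \<bullet> x)) *\<^sub>R x"

definition dual_update ::
  "('n::finite, 'j::finite, 'k::finite) channels \<Rightarrow> ('j, 'k) powers \<Rightarrow> ('j, 'k) powers
     \<Rightarrow> ('j, 'k) powers \<Rightarrow> real \<Rightarrow> ('j, 'k) powers \<Rightarrow> ('n, 'j, 'k) beams \<Rightarrow> ('j, 'k) powers"
  where
  "dual_update H w \<beta> \<sigma> P q U =
     normalize_power CARD('n) \<sigma> P (\<chi> m. \<beta> $ m / sinr_dual H w q U m * q $ m)"

definition primal_update ::
  "('n::finite, 'j::finite, 'k::finite) channels \<Rightarrow> ('j, 'k) powers \<Rightarrow> ('j, 'k) powers
     \<Rightarrow> ('j, 'k) powers \<Rightarrow> real \<Rightarrow> ('j, 'k) powers \<Rightarrow> ('n, 'j, 'k) beams \<Rightarrow> ('j, 'k) powers"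
  where
  "primal_update H w \<beta> \<sigma> P p U =
     normalize_power CARD('n) w P (\<chi> m. \<beta> $ m / sinr_primal H \<sigma> p U m * p $ m)"

definition converges_geometrically :: "(nat \<Rightarrow> 'a::real_normed_vector) \<Rightarrow> 'a \<Rightarrow> bool" where
  "converges_geometrically x l \<longleftrightarrow>
     (\<exists>C>0. \<exists>r\<in>{0<..<1}. \<forall>k. norm (x k - l) \<le> C * r ^ k)"

end

(*
For a fixed power q the MVDR beamformers minimise the interference-to-signal ratio of every user, so
for k >= 1 the dual updates iterate q -> f(q) / (sigma . f(q)), where f is a minimum of positive
affine maps with positive constant terms.  Hence q <= a q' with a >= 1 and q' feasible implies
f(q) <= (a (1 - eps) + eps) f(q'), which makes exp(d) - 1 contract by the factor 1 - eps, d being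
Hilbert's projective metric.  This yields an eigenvector of f, its uniqueness and optimality (a
feasible q with f(q) <= t q has t at least the eigenvalue), and geometric convergence of q.  The
beamformers depend Lipschitz continuously on q.  The primal iteration is a geometrically small
perturbation of the same kind of iteration for the limiting beamformers, hence converges
geometrically as well; its limit is jointly optimal by weak duality.
*)

theory Submission
  imports Defs
begin

text \<open>The asymmetry between the two problems shapes the proof. In the uplink the beam of user
  \<open>m\<close> enters only the SINR of \<open>m\<close>, so for a given power all beams can be
  optimised separately; in the downlink each beam also enters the interference of every other user,
  and there is no such minimum. Joint optimality is therefore established on the dual side, and the
  primal side is tied to it by transposing the gain matrix under equal budgets. The number
  \<epsilon> is a lower bound for the share of noise in noise plus interference. When a power vector
  grows by a factor \<open>a\<close> the noise stays put, so only the remaining share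
  \<open>1 - \<epsilon>\<close> grows. The budget bounds the interference and thereby makes
  \<epsilon> uniform over all feasible powers and unit beams. Projective estimates lose their force
  near the boundary of the orthant. Hence the lower bounds: on the normalised map, to keep limits
  positive, and on the own signals along the whole trajectory, to turn a small change of the beams
  into a small relative change of the primal map.\<close>

section \<open>Projective contraction\<close>

text \<open>
  The least \<open>e\<close> with \<open>hilbert_near e x y\<close> is \<open>exp d - 1\<close>, where \<open>d\<close> is Hilbert's projective metric.
\<close>

definition hilbert_near :: "real \<Rightarrow> real ^ 'i \<Rightarrow> real ^ 'i \<Rightarrow> bool" where
  "hilbert_near e x y \<longleftrightarrow>
     (\<exists>a b. 0 < a \<and> 0 < b \<and> (\<forall>i. x $ i \<le> a * y $ i) \<and> (\<forall>i. y $ i \<le> b * x $ i) \<and> a * b \<le> 1 + e)"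

lemma hilbert_near_mono: "hilbert_near e x y \<Longrightarrow> e \<le> e' \<Longrightarrow> hilbert_near e' x y"
  unfolding hilbert_near_def by (meson add_left_mono order_trans)

lemma hilbert_near_sym: "hilbert_near e x y \<Longrightarrow> hilbert_near e y x"
  unfolding hilbert_near_def by (metis mult.commute)

lemma hilbert_near_scale_left:
  assumes "hilbert_near e x y" "0 < s"
  shows "hilbert_near e (s *\<^sub>R x) y"
proof -
  obtain a b where ab: "0 < a" "0 < b" "\<And>i. x $ i \<le> a * y $ i" "\<And>i. y $ i \<le> b * x $ i"
    "a * b \<le> 1 + e"
    using assms(1) unfolding hilbert_near_def by blast
  show ?thesis unfolding hilbert_near_def
    using ab assms(2)
    by (intro exI[of _ "s * a"] exI[of _ "b / s"]) (auto simp: mult.assoc)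
qed

lemma hilbert_near_scale:
  assumes "hilbert_near e x y" "0 < s" "0 < t"
  shows "hilbert_near e (s *\<^sub>R x) (t *\<^sub>R y)"
  using assms by (meson hilbert_near_scale_left hilbert_near_sym)

text \<open>The triangle inequality of the metric, after exponentiation: comparison factors multiply
  along a chain, hence so do the bounds \<open>1 + d\<close> and \<open>1 + e\<close> on their
  products.\<close>

lemma hilbert_near_trans:
  assumes "hilbert_near d x y" "hilbert_near e y z"
  shows "hilbert_near ((1 + d) * (1 + e) - 1) x z"
proof -
  obtain a b where ab: "0 < a" "0 < b" "\<And>i. x $ i \<le> a * y $ i" "\<And>i. y $ i \<le> b * x $ i"
    "a * b \<le> 1 + d"
    using assms(1) unfolding hilbert_near_def by blast
  obtain a' b' where ab': "0 < a'" "0 < b'" "\<And>i. y $ i \<le> a' * z $ i" "\<And>i. z $ i \<le> b' * y $ i"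
    "a' * b' \<le> 1 + e"
    using assms(2) unfolding hilbert_near_def by blast
  have 1: "x $ i \<le> (a * a') * z $ i" for i
    using ab(1) ab(3)[of i] ab'(3)[of i] by (smt (verit) mult.assoc mult_left_mono)
  have 2: "z $ i \<le> (b' * b) * x $ i" for i
    using ab'(2) ab(4)[of i] ab'(4)[of i] by (smt (verit) mult.assoc mult_left_mono)
  have "0 < a * b" "0 < a' * b'" using ab ab' by auto
  then have "(a * b) * (a' * b') \<le> (1 + d) * (1 + e)"
    using ab(5) ab'(5) by (intro mult_mono) linarith+
  then have 3: "(a * a') * (b' * b) \<le> 1 + ((1 + d) * (1 + e) - 1)"
    by (simp add: mult_ac)
  show ?thesis unfolding hilbert_near_def
    using 1 2 3 ab(1,2) ab'(1,2)
    by (intro exI[of _ "a * a'"] exI[of _ "b' * b"]) simp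
qed

lemma vec_ratio_bound:
  fixes x y :: "real ^ 'i::finite"
  assumes "positive_vec x" "positive_vec y"
  shows "\<exists>a>0. \<forall>i. x $ i \<le> a * y $ i"
proof -
  define a where "a = (\<Sum>j\<in>UNIV. x $ j / y $ j)"
  have p: "0 < x $ j / y $ j" for j
    using assms by (simp add: positive_vec_def)
  have "x $ i / y $ i \<le> a" for i
    unfolding a_def using p by (intro member_le_sum) (auto intro: less_imp_le)
  then have "\<forall>i. x $ i \<le> a * y $ i"
    using assms by (simp add: positive_vec_def divide_le_eq)
  moreover have "0 < a" unfolding a_def using p by (intro sum_pos) auto
  ultimately show ?thesis by blast
qed

lemma hilbert_near_ex:
  fixes x y :: "real ^ 'i::finite"
  assumes "positive_vec x" "positive_vec y"
  shows "\<exists>e\<ge>0. hilbert_near e x y"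
proof -
  obtain a where a: "a > 0" "\<forall>i. x $ i \<le> a * y $ i" using vec_ratio_bound assms by blast
  obtain b where b: "b > 0" "\<forall>i. y $ i \<le> b * x $ i" using vec_ratio_bound assms by blast
  have "hilbert_near (a * b) x y" unfolding hilbert_near_def
    using a b by (intro exI[of _ a] exI[of _ b]) auto
  then show ?thesis using a b by (meson less_imp_le mult_pos_pos)
qed

lemma inner_positive_vec:
  fixes c x :: "real ^ 'i::finite"
  assumes "positive_vec c" "positive_vec x"
  shows "0 < c \<bullet> x"
  using assms unfolding inner_vec_def positive_vec_def by (intro sum_pos) auto

lemma inner_mono_positive_vec:
  fixes c x :: "real ^ 'i::finite"
  assumes "positive_vec c" "\<And>i. x $ i \<le> y $ i"
  shows "c \<bullet> x \<le> c \<bullet> y"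
  using assms unfolding inner_vec_def positive_vec_def
  by (intro sum_mono) (simp add: less_imp_le mult_left_mono)

text \<open>Pairing with the positive weight gives
  \<open>c \<bullet> x \<le> c \<bullet> y \<le> b * (c \<bullet> x)\<close>, and
  \<open>c \<bullet> x\<close> is positive.\<close>

lemma factor_ge_1:
  fixes c x :: "real ^ 'i::finite"
  assumes "positive_vec c" "positive_vec x" "c \<bullet> x \<le> c \<bullet> y" "\<And>i. y $ i \<le> b * x $ i"
  shows "1 \<le> b"
proof -
  have "c \<bullet> y \<le> c \<bullet> (b *\<^sub>R x)" using assms by (intro inner_mono_positive_vec) auto
  then have "c \<bullet> x \<le> b * (c \<bullet> x)" using assms(3) by simp
  then show ?thesis using inner_positive_vec[OF assms(1,2)] by simp
qed

text \<open>On a common level set of \<open>c\<close> each comparison factor is at least 1 on its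
  own; for unnormalised vectors only their product is. The contraction estimate depends on
  this.\<close>

lemma hilbert_near_same_inner:
  fixes c x :: "real ^ 'i::finite"
  assumes "hilbert_near e x y" "positive_vec c" "positive_vec x" "positive_vec y" "c \<bullet> x = c \<bullet> y"
  obtains a b where "1 \<le> a" "1 \<le> b" "\<And>i. x $ i \<le> a * y $ i" "\<And>i. y $ i \<le> b * x $ i"
    "a * b \<le> 1 + e"
proof -
  obtain a b where ab: "0 < a" "0 < b" "\<And>i. x $ i \<le> a * y $ i" "\<And>i. y $ i \<le> b * x $ i"
    "a * b \<le> 1 + e"
    using assms(1) unfolding hilbert_near_def by blast
  have "1 \<le> a" using factor_ge_1[of c y x a] assms ab(3) by simp
  moreover have "1 \<le> b" using factor_ge_1[of c x y b] assms ab(4) by simp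
  ultimately show ?thesis using that ab by blast
qed

lemma component_le_inner:
  fixes c x :: "real ^ 'i::finite"
  assumes "positive_vec c" "positive_vec x"
  shows "x $ i \<le> (c \<bullet> x) / c $ i"
proof -
  have "c $ i * x $ i \<le> c \<bullet> x" unfolding inner_vec_def
    using assms member_le_sum[of i UNIV "\<lambda>i. c $ i * x $ i"]
    by (simp add: positive_vec_def less_imp_le)
  then show ?thesis using assms by (simp add: positive_vec_def field_simps)
qed

text \<open>Since both factors are at least 1, each is at most their product, hence at most
  \<open>1 + e\<close>. The components then differ by at most \<open>e\<close> times the larger one,
  which the level set bounds by \<open>(c \<bullet> y) / c $ i\<close>.\<close>

lemma hilbert_near_component_dist:
  fixes c x :: "real ^ 'i::finite"
  assumes "hilbert_near e x y" "positive_vec c" "positive_vec x" "positive_vec y" "c \<bullet> x = c \<bullet> y"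
  shows "\<bar>x $ i - y $ i\<bar> \<le> e * ((c \<bullet> y) / c $ i)"
proof -
  obtain a b where ab: "1 \<le> a" "1 \<le> b" "\<And>i. x $ i \<le> a * y $ i" "\<And>i. y $ i \<le> b * x $ i"
    "a * b \<le> 1 + e"
    using hilbert_near_same_inner[OF assms] by blast
  have pos: "0 < x $ i" "0 < y $ i" using assms by (auto simp: positive_vec_def)
  have "a * 1 \<le> a * b" using ab by (intro mult_left_mono) auto
  moreover have "1 * b \<le> a * b" using ab by (intro mult_right_mono) auto
  ultimately have le: "a \<le> 1 + e" "b \<le> 1 + e" "0 \<le> e" using ab by linarith+
  have m: "x $ i \<le> (c \<bullet> y) / c $ i" "y $ i \<le> (c \<bullet> y) / c $ i"
    using component_le_inner[of c] assms by metis+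
  have "a * y $ i \<le> (1 + e) * y $ i" "b * x $ i \<le> (1 + e) * x $ i"
    using le pos by (auto intro!: mult_right_mono)
  then have "x $ i - y $ i \<le> e * y $ i" "y $ i - x $ i \<le> e * x $ i"
    using ab(3)[of i] ab(4)[of i] by (auto simp: algebra_simps)
  moreover have "e * y $ i \<le> e * ((c \<bullet> y) / c $ i)" "e * x $ i \<le> e * ((c \<bullet> y) / c $ i)"
    using m le(3) by (meson mult_left_mono)+
  ultimately show ?thesis by linarith
qed

lemma hilbert_near_norm_dist:
  fixes c x :: "real ^ 'i::finite"
  assumes "hilbert_near e x y" "positive_vec c" "positive_vec x" "positive_vec y" "c \<bullet> x = c \<bullet> y"
  shows "norm (x - y) \<le> e * (\<Sum>i\<in>UNIV. (c \<bullet> y) / c $ i)"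
proof -
  have "norm (x - y) \<le> (\<Sum>i\<in>UNIV. \<bar>(x - y) $ i\<bar>)" by (rule norm_le_l1_cart)
  also have "\<dots> \<le> (\<Sum>i\<in>UNIV. e * ((c \<bullet> y) / c $ i))"
    using hilbert_near_component_dist[OF assms] by (intro sum_mono) simp
  finally show ?thesis by (simp add: sum_distrib_left)
qed

section \<open>Linear recursions with geometrically small perturbations\<close>

lemma perturbed_contraction_geometric:
  fixes e d :: "nat \<Rightarrow> real"
  assumes "\<epsilon> \<in> {0<..<1}" "r \<in> {0<..<1}"
    and step: "\<And>k. e (Suc k) \<le> (1 - \<epsilon>) * (1 + d k) * e k + d k"
    and d: "\<And>k. 0 \<le> d k" "\<And>k. d k \<le> C * r ^ k"
    and e: "\<And>k. 0 \<le> e k"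
  shows "\<exists>K>0. \<exists>\<rho>\<in>{0<..<1}. \<forall>k. e k \<le> K * \<rho> ^ k"
proof -
  have C: "0 \<le> C" using d(1)[of 0] d(2)[of 0] by simp
  \<comment> \<open>Once \<open>d k\<close> is at most \<open>\<epsilon> / 2\<close>, the
    coefficient \<open>(1 - \<epsilon>) * (1 + d k)\<close> is at most \<open>a\<close>. A rate
    \<open>\<rho>\<close> strictly above both \<open>a\<close> and \<open>r\<close> then leaves room
    for the additive term.\<close>
  define a where "a = 1 - \<epsilon> / 2"
  have a: "0 < a" "a < 1" using assms(1) by (auto simp: a_def)
  obtain \<rho> where \<rho>: "a < \<rho>" "r < \<rho>" "\<rho> < 1"
    using dense[of "max a r" 1] a assms(2) by auto
  have "(\<lambda>k. C * r ^ k) \<longlonglongrightarrow> C * 0"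
    using assms(2) by (intro tendsto_intros LIMSEQ_power_zero) auto
  then have "\<forall>\<^sub>F k in sequentially. C * r ^ k < \<epsilon> / 2"
    using assms(1) by (intro order_tendstoD) auto
  then obtain k0 where k0: "\<And>k. k \<ge> k0 \<Longrightarrow> C * r ^ k < \<epsilon> / 2"
    by (auto simp: eventually_sequentially)
  \<comment> \<open>The sum settles the indices up to \<open>k0\<close>, the second term gives
    \<open>C \<le> K * (\<rho> - a)\<close>, which is what the induction step needs, and the 1 makes
    \<open>K\<close> positive.\<close>
  define K where "K = (\<Sum>j\<le>k0. e j / \<rho> ^ j) + C / (\<rho> - a) + 1"
  have \<rho>0: "0 < \<rho>" using \<rho> a by linarith
  have s: "0 \<le> (\<Sum>j\<le>k0. e j / \<rho> ^ j)" using e \<rho>0 by (intro sum_nonneg) auto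
  have Ca: "0 \<le> C / (\<rho> - a)" using C \<rho> by auto
  have K: "0 < K" unfolding K_def using s Ca by linarith
  have "C / (\<rho> - a) \<le> K" unfolding K_def using s by linarith
  then have KC: "C \<le> K * (\<rho> - a)" using \<rho> by (simp add: divide_le_eq)
  have init: "e j \<le> K * \<rho> ^ j" if "j \<le> k0" for j
  proof -
    have "e j / \<rho> ^ j \<le> (\<Sum>j\<le>k0. e j / \<rho> ^ j)"
      using that e \<rho>0 by (intro member_le_sum) auto
    also have "\<dots> \<le> K" unfolding K_def using Ca by linarith
    finally show ?thesis using \<rho>0 by (simp add: divide_le_eq)
  qed
  have "e k \<le> K * \<rho> ^ k" for k
  proof (cases "k \<le> k0")
    case True
    then show ?thesis by (rule init)
  next
    case False
    then have "k0 \<le> k" by simp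
    then show ?thesis
    proof (induction k rule: dec_induct)
      case base
      show ?case by (rule init) simp
    next
      case (step k)
      have dk: "d k \<le> \<epsilon> / 2" using d(2)[of k] k0[OF step(1)] by linarith
      have "(1 - \<epsilon>) * (1 + d k) \<le> (1 - \<epsilon>) * (1 + \<epsilon> / 2)"
        using dk assms(1) by (intro mult_left_mono) auto
      also have "\<dots> \<le> a" unfolding a_def using assms(1) by (simp add: algebra_simps)
      finally have "(1 - \<epsilon>) * (1 + d k) * e k \<le> a * e k"
        using e[of k] by (rule mult_right_mono)
      also have "\<dots> \<le> a * (K * \<rho> ^ k)" using step.IH a by (intro mult_left_mono) auto
      finally have "e (Suc k) \<le> a * (K * \<rho> ^ k) + d k" using assms(3)[of k] by linarith
      moreover have "d k \<le> C * \<rho> ^ k"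
        using d(2)[of k] C \<rho> assms(2)
        by (meson greaterThanLessThan_iff less_imp_le mult_left_mono order_trans power_mono)
      moreover have "C * \<rho> ^ k \<le> K * (\<rho> - a) * \<rho> ^ k"
        using KC \<rho>0 by (intro mult_right_mono) auto
      ultimately show ?case by (simp add: algebra_simps)
    qed
  qed
  then show ?thesis using K \<rho> \<rho>0
    by (intro exI[of _ K] conjI bexI[of _ \<rho>]) auto
qed

text \<open>The factor in \<open>sub\<close> equals \<open>1 + (1 - \<epsilon>) * (a - 1)\<close>:
  the excess of \<open>a\<close> over 1 shrinks by \<open>1 - \<epsilon>\<close>. Only
  \<open>y\<close> is subject to the budget, since \<epsilon> stands for a guaranteed share of the
  constant term in \<open>f y\<close>. The uniform bound \<open>low\<close> keeps normalised
  iterates off the boundary of the orthant.\<close>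

locale subhomogeneous_map =
  fixes f :: "real ^ 'i::finite \<Rightarrow> real ^ 'i" and c :: "real ^ 'i" and B l \<epsilon> :: real
  assumes c: "positive_vec c" and B: "0 < B" and \<epsilon>: "0 < \<epsilon>" "\<epsilon> < 1" and l: "0 < l"
    and low: "\<And>x i. positive_vec x \<Longrightarrow> l \<le> f x $ i"
    and sub: "\<And>x y a i. positive_vec x \<Longrightarrow> positive_vec y \<Longrightarrow> c \<bullet> y \<le> B \<Longrightarrow> 1 \<le> a \<Longrightarrow>
      (\<And>i. x $ i \<le> a * y $ i) \<Longrightarrow> f x $ i \<le> (a * (1 - \<epsilon>) + \<epsilon>) * f y $ i"
begin

definition T :: "real ^ 'i \<Rightarrow> real ^ 'i" where
  "T x = (B / (c \<bullet> f x)) *\<^sub>R f x"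

lemma positive_f: "positive_vec x \<Longrightarrow> positive_vec (f x)"
  using low l unfolding positive_vec_def by (meson less_le_trans positive_vec_def)

lemma scale_pos: "positive_vec x \<Longrightarrow> 0 < B / (c \<bullet> f x)"
  using B c inner_positive_vec positive_f by fastforce

lemma positive_T: "positive_vec x \<Longrightarrow> positive_vec (T x)"
  using positive_f[of x] scale_pos[of x]
  unfolding T_def by (simp add: positive_vec_def del: times_divide_eq_left)

lemma inner_T: "positive_vec x \<Longrightarrow> c \<bullet> T x = B"
  using inner_positive_vec[OF c positive_f] by (fastforce simp: T_def)

lemma sub_weak:
  assumes "positive_vec x" "positive_vec y" "c \<bullet> y \<le> B" "1 \<le> a" "\<And>i. x $ i \<le> a * y $ i"
  shows "f x $ i \<le> a * f y $ i"
proof -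
  have "0 \<le> (a - 1) * \<epsilon>" using assms(4) \<epsilon> by simp
  then have "a * (1 - \<epsilon>) + \<epsilon> \<le> a" by (simp add: algebra_simps)
  then have "(a * (1 - \<epsilon>) + \<epsilon>) * f y $ i \<le> a * f y $ i"
    using low[OF assms(2), of i] l by (intro mult_right_mono) auto
  then show ?thesis using sub[OF assms, of i] by linarith
qed

lemma contraction:
  assumes "hilbert_near e x y" "positive_vec x" "positive_vec y" "c \<bullet> x = B" "c \<bullet> y = B"
  shows "hilbert_near ((1 - \<epsilon>) * e) (f x) (f y)"
proof -
  obtain a b where ab: "1 \<le> a" "1 \<le> b" "\<And>i. x $ i \<le> a * y $ i" "\<And>i. y $ i \<le> b * x $ i"
    "a * b \<le> 1 + e"
    using hilbert_near_same_inner[OF assms(1) c assms(2,3)] assms(4,5) by auto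
  let ?a = "a * (1 - \<epsilon>) + \<epsilon>" and ?b = "b * (1 - \<epsilon>) + \<epsilon>"
  have 1: "f x $ i \<le> ?a * f y $ i" for i
    by (rule sub) (use assms ab in auto)
  have 2: "f y $ i \<le> ?b * f x $ i" for i
    by (rule sub) (use assms ab in auto)
  \<comment> \<open>This is exactly the gap between
    \<open>(1 - \<epsilon>) * (a * b) + \<epsilon>\<close> and \<open>?a * ?b\<close>; its sign is
    where \<open>1 \<le> a\<close> and \<open>1 \<le> b\<close> are used.\<close>
  have "0 \<le> \<epsilon> * (1 - \<epsilon>) * ((a - 1) * (b - 1))"
    using \<epsilon> ab by simp
  then have "?a * ?b \<le> (1 - \<epsilon>) * (a * b) + \<epsilon>" by (simp add: algebra_simps)
  also have "\<dots> \<le> (1 - \<epsilon>) * (1 + e) + \<epsilon>"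
    using \<epsilon> ab(5) by (intro add_right_mono mult_left_mono) auto
  finally have 3: "?a * ?b \<le> 1 + (1 - \<epsilon>) * e" by (simp add: algebra_simps)
  have "0 < ?a" "0 < ?b" using ab \<epsilon> by (auto intro: add_nonneg_pos)
  then show ?thesis unfolding hilbert_near_def using 1 2 3 by blast
qed

lemma contraction_T:
  assumes "hilbert_near e x y" "positive_vec x" "positive_vec y" "c \<bullet> x = B" "c \<bullet> y = B"
  shows "hilbert_near ((1 - \<epsilon>) * e) (T x) (T y)"
  unfolding T_def using contraction[OF assms] scale_pos assms(2,3)
  by (intro hilbert_near_scale) auto

text \<open>Rescaling does not affect \<open>hilbert_near\<close>, so the different normalising
  factors of \<open>g k\<close> and \<open>f\<close> cost nothing. The perturbation has to be
  controlled only on the level set of \<open>c\<close>, where all iterates lie. With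
  \<open>d = 0\<close> the lemma covers the unperturbed iteration as well.\<close>

lemma perturbed_iteration_converges:
  assumes x: "\<And>k. x (Suc k) = (B / (c \<bullet> g k (x k))) *\<^sub>R g k (x k)"
    and g: "\<And>k y. positive_vec y \<Longrightarrow> positive_vec (g k y)"
    and near: "\<And>k y. positive_vec y \<Longrightarrow> c \<bullet> y = B \<Longrightarrow> hilbert_near (d k) (g k y) (f y)"
    and d: "\<And>k. 0 \<le> d k" "\<And>k. d k \<le> C * r ^ k" "r \<in> {0<..<1}"
    and x0: "positive_vec (x 0)" "c \<bullet> x 0 = B"
    and z: "positive_vec z" "c \<bullet> z = B" "T z = z"
  shows "converges_geometrically x z"
proof -
  have gp: "0 < c \<bullet> g k y" if "positive_vec y" for k y
    using inner_positive_vec[OF c g[OF that]] .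
  have pos: "positive_vec (x k) \<and> c \<bullet> x k = B" for k
  proof (induction k)
    case 0
    then show ?case using x0 by simp
  next
    case (Suc k)
    then have "0 < c \<bullet> g k (x k)" using gp by blast
    then show ?case using g[of "x k" k] Suc B unfolding x by (auto simp: positive_vec_def)
  qed
  obtain e0 where e0: "0 \<le> e0" "hilbert_near e0 (x 0) z"
    using hilbert_near_ex x0 z by blast
  \<comment> \<open>The recursion is \<open>(1 + d k) * (1 + (1 - \<epsilon>) * e k) - 1\<close>
    multiplied out: one contraction by \<open>f\<close>, then the triangle inequality.\<close>
  define e where "e = rec_nat e0 (\<lambda>k ek. (1 - \<epsilon>) * (1 + d k) * ek + d k)"
  have eS: "e (Suc k) = (1 - \<epsilon>) * (1 + d k) * e k + d k" for k by (simp add: e_def)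
  have enn: "0 \<le> e k" for k
  proof (induction k)
    case (Suc k)
    then show ?case using \<epsilon> d(1)[of k] unfolding eS by simp
  qed (use e0 in \<open>simp add: e_def\<close>)
  have hn: "hilbert_near (e k) (x k) z" for k
  proof (induction k)
    case 0
    then show ?case using e0 by (simp add: e_def)
  next
    case (Suc k)
    have "hilbert_near ((1 - \<epsilon>) * e k) (f (x k)) (f z)"
      using contraction[OF Suc] pos z by blast
    from hilbert_near_trans[OF near this] pos
    have "hilbert_near (e (Suc k)) (g k (x k)) (f z)"
      unfolding eS by (simp add: algebra_simps)
    then have "hilbert_near (e (Suc k)) (x (Suc k)) (T z)"
      unfolding x T_def using scale_pos[OF z(1)] gp[of "x k" k] pos[of k] B
      by (intro hilbert_near_scale) auto
    then show ?case using z by simp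
  qed
  obtain K \<rho> where K: "K > 0" "\<rho> \<in> {0<..<1}" "\<And>k. e k \<le> K * \<rho> ^ k"
    using perturbed_contraction_geometric[of \<epsilon> r e d C] \<epsilon> d eS enn by auto
  define M where "M = (\<Sum>i\<in>UNIV. (c \<bullet> z) / c $ i)"
  have M: "0 < M" unfolding M_def using z B c
    by (intro sum_pos) (auto simp: positive_vec_def)
  have "norm (x k - z) \<le> (K * M) * \<rho> ^ k" for k
  proof -
    have "norm (x k - z) \<le> e k * M" unfolding M_def
      using pos z c hn by (intro hilbert_near_norm_dist) auto
    also have "\<dots> \<le> (K * \<rho> ^ k) * M" using K M by (intro mult_right_mono) auto
    finally show ?thesis by (simp add: mult_ac)
  qed
  then show ?thesis unfolding converges_geometrically_def using K M by (meson mult_pos_pos)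
qed

section \<open>Existence of a fixed point of the normalised map\<close>

lemma f_upper: "\<exists>u>0. \<forall>x i. positive_vec x \<longrightarrow> c \<bullet> x = B \<longrightarrow> f x $ i \<le> u"
proof -
  \<comment> \<open>The budget split equally over the weighted components. Every \<open>x\<close> on
    the level set satisfies \<open>x $ j \<le> B / c $ j\<close>, so it is dominated by
    \<open>CARD('i)\<close> times this single vector.\<close>
  define y :: "real ^ 'i" where "y = (\<chi> i. B / (c $ i * CARD('i)))"
  have y: "positive_vec y" using c B by (simp add: y_def positive_vec_def)
  have cn: "c $ i \<noteq> 0" for i using c by (metis less_irrefl positive_vec_def)
  have cy: "c \<bullet> y = B" using cn by (simp add: y_def inner_vec_def)
  have "f x $ i \<le> CARD('i) * (\<Sum>j\<in>UNIV. f y $ j)" if x: "positive_vec x" "c \<bullet> x = B" for x i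
  proof -
    have "x $ j \<le> CARD('i) * y $ j" for j
      using component_le_inner[OF c x(1), of j] x(2) by (simp add: y_def field_simps)
    then have "f x $ i \<le> CARD('i) * f y $ i"
      using x y cy by (intro sub_weak) (auto simp: Suc_le_eq)
    also have "\<dots> \<le> CARD('i) * (\<Sum>j\<in>UNIV. f y $ j)"
      using positive_f[OF y]
      by (intro mult_left_mono member_le_sum) (auto simp: positive_vec_def intro: less_imp_le)
    finally show ?thesis .
  qed
  moreover have "0 < CARD('i) * (\<Sum>j\<in>UNIV. f y $ j)"
    using positive_f[OF y] by (auto simp: positive_vec_def intro!: sum_pos mult_pos_pos)
  ultimately show ?thesis by blast
qed

text \<open>On the level set \<open>f\<close> is bounded above, so the normalising factor is bounded
  below, and \<open>f\<close> itself is at least \<open>l\<close>. This keeps the limit of the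
  iterates strictly positive.\<close>

lemma T_lower: "\<exists>m>0. \<forall>x i. positive_vec x \<longrightarrow> c \<bullet> x = B \<longrightarrow> m \<le> T x $ i"
proof -
  obtain u where u: "u > 0" "\<And>x i. positive_vec x \<Longrightarrow> c \<bullet> x = B \<Longrightarrow> f x $ i \<le> u"
    using f_upper by blast
  define s where "s = c \<bullet> (\<chi> i. u)"
  have s: "0 < s" unfolding s_def
    by (intro inner_positive_vec[OF c]) (simp add: positive_vec_def u(1))
  have "B / s * l \<le> T x $ i" if x: "positive_vec x" "c \<bullet> x = B" for x i
  proof -
    have "c \<bullet> f x \<le> s" unfolding s_def
      by (intro inner_mono_positive_vec[OF c]) (simp add: u(2)[OF x])
    then have "B / s \<le> B / (c \<bullet> f x)"
      using s B inner_positive_vec[OF c positive_f[OF x(1)]] by (simp add: frac_le)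
    then have "B / s * l \<le> B / (c \<bullet> f x) * f x $ i"
      using low[OF x(1), of i] l less_imp_le[OF scale_pos[OF x(1)]]
      by (metis less_imp_le mult_mono)
    then show ?thesis by (simp add: T_def)
  qed
  then show ?thesis using s B l by (intro exI[of _ "B / s * l"]) auto
qed

text \<open>Banach iteration, with the completeness of the norm in place of that of the projective
  metric: the projective distance of successive iterates decays geometrically, hence their norm
  distance is summable. That the limit is fixed needs continuity of \<open>T\<close> there, which
  \<open>sub_weak\<close> provides.\<close>

lemma fixed_point_ex: "\<exists>z. positive_vec z \<and> c \<bullet> z = B \<and> T z = z"
proof -
  define y :: "real ^ 'i" where "y = (\<chi> i. 1)"
  have y: "positive_vec y" by (simp add: y_def positive_vec_def)
  \<comment> \<open>One application of \<open>T\<close> at the start puts even the zeroth iterate on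
    the level set.\<close>
  define x where "x k = (T ^^ Suc k) y" for k
  have xS: "x (Suc k) = T (x k)" for k by (simp add: x_def)
  have pos: "positive_vec (x k)" "c \<bullet> x k = B" for k
  proof -
    have "positive_vec ((T ^^ k) y)" by (induction k) (auto simp: y positive_T)
    then show "positive_vec (x k)" "c \<bullet> x k = B" by (auto simp: x_def positive_T inner_T)
  qed
  obtain e where e: "0 \<le> e" "hilbert_near e (x 1) (x 0)"
    using hilbert_near_ex[OF pos(1) pos(1)] by blast
  have hn: "hilbert_near ((1 - \<epsilon>) ^ k * e) (x (Suc k)) (x k)" for k
  proof (induction k)
    case (Suc k)
    then show ?case using contraction_T[OF Suc pos(1) pos(1) pos(2) pos(2)]
      by (simp add: xS mult_ac)
  qed (use e in simp)
  define M where "M = (\<Sum>i\<in>UNIV. B / c $ i)"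
  have "norm (x (Suc k) - x k) \<le> (1 - \<epsilon>) ^ k * (e * M)" for k
    using hilbert_near_norm_dist[OF hn c pos(1) pos(1)] unfolding pos(2) M_def
    by (simp add: mult.assoc)
  moreover have "summable (\<lambda>k. (1 - \<epsilon>) ^ k * (e * M))"
    using \<epsilon> by (intro summable_mult2 summable_geometric) auto
  ultimately have "summable (\<lambda>k. x (Suc k) - x k)"
    using summable_comparison_test'[where N = 0 and f = "\<lambda>k. x (Suc k) - x k"] by simp
  then have "convergent (\<lambda>n. \<Sum>k<n. x (Suc k) - x k)" by (simp add: summable_iff_convergent)
  then have "convergent (\<lambda>n. x n - x 0)" by (simp add: sum_lessThan_telescope)
  then have "convergent x" by (simp add: convergent_diff_const_right_iff)
  then obtain z where z: "x \<longlonglongrightarrow> z" by (auto simp: convergent_def)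
  obtain m where m: "m > 0" "\<And>x i. positive_vec x \<Longrightarrow> c \<bullet> x = B \<Longrightarrow> m \<le> T x $ i"
    using T_lower by blast
  have xm: "m \<le> x (Suc k) $ i" for k i using m(2)[OF pos] by (simp add: xS)
  have zi: "(\<lambda>k. x (Suc k) $ i) \<longlonglongrightarrow> z $ i" for i
    by (rule tendsto_vec_nth[OF LIMSEQ_Suc[OF z]])
  have zm: "m \<le> z $ i" for i
    by (rule LIMSEQ_le_const[OF zi]) (use xm in blast)
  have zpos: "positive_vec z" unfolding positive_vec_def using less_le_trans[OF m(1) zm] by blast
  have "(\<lambda>k. c \<bullet> x k) \<longlonglongrightarrow> c \<bullet> z" by (rule tendsto_inner[OF tendsto_const z])
  then have zB: "c \<bullet> z = B" unfolding pos(2) by (simp add: LIMSEQ_const_iff)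
  \<comment> \<open>As all components involved are at least \<open>m\<close>, a difference of norm
    \<open>\<delta>\<close> is a relative change of at most \<open>\<delta> / m\<close>. So
    \<open>x (Suc k)\<close> and \<open>z\<close> dominate each other with a factor tending to 1,
    and \<open>f\<close> preserves this.\<close>
  define a where "a k = 1 + norm (x (Suc k) - z) / m" for k
  have a1: "1 \<le> a k" for k using m by (simp add: a_def)
  have dist: "\<bar>x (Suc k) $ i - z $ i\<bar> \<le> norm (x (Suc k) - z)" for k i
    by (metis component_le_norm_cart vector_minus_component)
  have xa: "x (Suc k) $ i \<le> a k * z $ i" and za: "z $ i \<le> a k * x (Suc k) $ i" for k i
  proof -
    have "norm (x (Suc k) - z) / m * m \<le> norm (x (Suc k) - z) / m * z $ i"
      "norm (x (Suc k) - z) / m * m \<le> norm (x (Suc k) - z) / m * x (Suc k) $ i"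
      using m(1) by (intro mult_left_mono zm xm; simp)+
    then show "x (Suc k) $ i \<le> a k * z $ i" "z $ i \<le> a k * x (Suc k) $ i"
      using dist[of k i] m(1) by (auto simp: a_def distrib_right)
  qed
  have fa: "f (x (Suc k)) $ i \<le> a k * f z $ i" "f z $ i \<le> a k * f (x (Suc k)) $ i" for i k
    using sub_weak[OF pos(1) zpos eq_refl[OF zB] a1 xa]
      sub_weak[OF zpos pos(1) eq_refl[OF pos(2)] a1 za] by blast+
  have "hilbert_near (a k * a k - 1) (f (x (Suc k))) (f z)" for k
  proof -
    have "0 < a k" using a1[of k] by linarith
    then show ?thesis unfolding hilbert_near_def using fa[where k = k]
      by (intro exI[of _ "a k"]) simp
  qed
  then have "hilbert_near (a k * a k - 1) (T (x (Suc k))) (T z)" for k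
    unfolding T_def by (rule hilbert_near_scale) (rule scale_pos[OF pos(1)] scale_pos[OF zpos])+
  then have bnd: "norm (x (Suc (Suc k)) - T z) \<le> (a k * a k - 1) * (\<Sum>i\<in>UNIV. B / c $ i)" for k
    using hilbert_near_norm_dist[OF _ c positive_T[OF pos(1)] positive_T[OF zpos]]
    by (simp add: inner_T[OF zpos] inner_T[OF pos(1)] xS[of "Suc k"])
  have "(\<lambda>k. norm (x (Suc k) - z)) \<longlonglongrightarrow> 0"
    using LIMSEQ_Suc[OF z] by (simp add: LIM_zero tendsto_norm_zero)
  then have "a \<longlonglongrightarrow> 1 + 0 / m" unfolding a_def using m by (intro tendsto_intros) auto
  then have "(\<lambda>k. (a k * a k - 1) * (\<Sum>i\<in>UNIV. B / c $ i)) \<longlonglongrightarrow> ((1 + 0/m) * (1 + 0/m) - 1) * (\<Sum>i\<in>UNIV. B / c $ i)"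
    by (intro tendsto_intros)
  then have "(\<lambda>k. x (Suc (Suc k)) - T z) \<longlonglongrightarrow> 0"
    by (intro Lim_null_comparison[OF always_eventually[OF allI[OF bnd]]]) simp
  then have "(\<lambda>k. x (Suc (Suc k))) \<longlonglongrightarrow> T z" by (simp add: LIM_zero_iff)
  moreover have "(\<lambda>k. x (Suc (Suc k))) \<longlonglongrightarrow> z" by (rule LIMSEQ_Suc[OF LIMSEQ_Suc[OF z]])
  ultimately have "T z = z" using LIMSEQ_unique by blast
  then show ?thesis using zpos zB by blast
qed

section \<open>Eigenvectors and subeigenvectors\<close>

lemma eigenvector_ex:
  obtains z \<nu> where "positive_vec z" "c \<bullet> z = B" "T z = z" "0 < \<nu>" "f z = \<nu> *\<^sub>R z"
proof -
  obtain z where z: "positive_vec z" "c \<bullet> z = B" "T z = z" using fixed_point_ex by blast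
  define \<nu> where "\<nu> = (c \<bullet> f z) / B"
  have "0 < c \<bullet> f z" using inner_positive_vec c positive_f z by blast
  then have "0 < \<nu>" "\<nu> *\<^sub>R T z = f z" using B by (auto simp: \<nu>_def T_def)
  then show ?thesis using z that by metis
qed

text \<open>A touching argument: take the least \<open>a\<close> with \<open>z \<le> a y\<close> and
  a component \<open>j\<close> where equality holds. There the eigenvalue equation and
  \<open>sub\<close> give \<open>\<nu> * a \<le> (a - \<epsilon> * (a - 1)) * \<nu>'\<close>, which
  with \<open>\<nu>' \<le> \<nu>\<close> forces \<open>a = 1\<close> and equal eigenvalues. Then
  \<open>z \<le> y\<close>, and the budget of \<open>y\<close> excludes strict inequality in any
  component. Optimality and uniqueness of the powers both rest on this.\<close>

lemma subeigenvector_unique: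
  assumes z: "positive_vec z" "c \<bullet> z = B" "f z = \<nu> *\<^sub>R z"
    and y: "positive_vec y" "c \<bullet> y \<le> B" "\<And>i. f y $ i \<le> \<nu>' * y $ i"
    and le: "0 < \<nu>'" "\<nu>' \<le> \<nu>"
  shows "\<nu>' = \<nu> \<and> y = z"
proof -
  define a where "a = Max (range (\<lambda>i. z $ i / y $ i))"
  have yp: "0 < y $ i" for i using y by (simp add: positive_vec_def)
  have "a \<in> range (\<lambda>i. z $ i / y $ i)" unfolding a_def by (intro Max_in) auto
  then obtain j where j: "a = z $ j / y $ j" by blast
  have "z $ i / y $ i \<le> a" for i unfolding a_def by (intro Max_ge) auto
  then have za: "z $ i \<le> a * y $ i" for i using yp by (simp add: divide_le_eq)
  have a1: "1 \<le> a" using factor_ge_1[of c y z a] c y z za by simp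
  have "\<nu> * (a * y $ j) = f z $ j" using j yp[of j] by (simp add: z)
  also have "\<dots> \<le> (a * (1 - \<epsilon>) + \<epsilon>) * f y $ j"
    using sub[OF z(1) y(1,2) a1] za by blast
  also have "\<dots> \<le> (a * (1 - \<epsilon>) + \<epsilon>) * (\<nu>' * y $ j)"
    using y(3)[of j] a1 \<epsilon> by (intro mult_left_mono) auto
  finally have "(\<nu> * a) * y $ j \<le> ((a - \<epsilon> * (a - 1)) * \<nu>') * y $ j" by (simp add: algebra_simps)
  then have le1: "\<nu> * a \<le> (a - \<epsilon> * (a - 1)) * \<nu>'" using yp[of j] by simp
  have "\<nu>' * a \<le> \<nu> * a" using le a1 by (intro mult_right_mono) auto
  then have "\<epsilon> * (a - 1) * \<nu>' \<le> 0" using le1 by (simp add: algebra_simps)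
  moreover have "0 \<le> \<epsilon> * (a - 1) * \<nu>'" using \<epsilon> a1 le by simp
  ultimately have a: "a = 1" using \<epsilon> le by simp
  then have "\<nu>' = \<nu>" using le1 le by simp
  moreover have "y = z"
  proof (rule ccontr)
    assume "y \<noteq> z"
    then obtain i where "z $ i \<noteq> y $ i" by (metis vec_eq_iff)
    then have "z $ i < y $ i" using za[of i] a by simp
    then have "c \<bullet> z < c \<bullet> y" unfolding inner_vec_def using za a c
      by (intro sum_strict_mono_ex1) (auto simp: positive_vec_def less_imp_le)
    then show False using y z by simp
  qed
  ultimately show ?thesis by blast
qed

end

section \<open>The beamformers\<close>

lemma herm_prod_cnj: "cnj (herm_prod x y) = herm_prod y x"
  by (simp add: herm_prod_def mult.commute)

lemma herm_prod_add_right: "herm_prod x (y + z) = herm_prod x y + herm_prod x z"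
  by (simp add: herm_prod_def algebra_simps sum.distrib)

lemma herm_prod_diff_right: "herm_prod x (y - z) = herm_prod x y - herm_prod x z"
  by (simp add: herm_prod_def algebra_simps sum_subtractf)

lemma herm_prod_diff_left: "herm_prod (x - y) z = herm_prod x z - herm_prod y z"
  by (simp add: herm_prod_def algebra_simps sum_subtractf)

lemma herm_prod_cmult_right: "herm_prod x (a *s y) = a * herm_prod x y"
  by (simp add: herm_prod_def sum_distrib_left mult_ac)

lemma herm_prod_cmult_left: "herm_prod (a *s x) y = cnj a * herm_prod x y"
  by (simp add: herm_prod_def sum_distrib_left mult_ac)

lemma herm_prod_scaleR_right: "herm_prod x (a *\<^sub>R y) = of_real a * herm_prod x y"
  by (simp add: herm_prod_def sum_distrib_left scaleR_conv_of_real[where 'a = complex] mult_ac)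

lemma herm_prod_sum_right: "herm_prod x (\<Sum>n\<in>A. f n) = (\<Sum>n\<in>A. herm_prod x (f n))"
  by (induction A rule: infinite_finite_induct)
    (auto simp: herm_prod_add_right, simp_all add: herm_prod_def)

lemma herm_prod_self: "herm_prod x x = of_real ((norm x)\<^sup>2)"
  by (simp add: herm_prod_def norm_vec_def L2_set_def sum_nonneg real_sqrt_pow2
      complex_norm_square[symmetric] mult.commute[of "cnj _"] del: of_real_power)

lemma cmod_herm_prod_le: "cmod (herm_prod x y) \<le> norm x * norm y"
proof -
  have "cmod (herm_prod x y) \<le> (\<Sum>i\<in>UNIV. \<bar>cmod (x $ i)\<bar> * \<bar>cmod (y $ i)\<bar>)"
    unfolding herm_prod_def by (rule order_trans[OF norm_sum]) (simp add: norm_mult)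
  also have "\<dots> \<le> norm x * norm y" unfolding norm_vec_def by (rule L2_set_mult_ineq)
  finally show ?thesis .
qed

lemma norm_cmult_vec: "norm (a *s x) = cmod a * norm x" for x :: "complex ^ 'n"
  by (simp add: norm_vec_def L2_set_def norm_mult power_mult_distrib sum_distrib_left[symmetric]
      real_sqrt_mult)

lemma herm_outer_mult: "herm_outer h *v x = herm_prod h x *s h"
  by (simp add: herm_outer_def herm_prod_def matrix_vector_mult_def vec_eq_iff sum_distrib_left
      mult_ac)

lemma scaleR_matrix_vector: "(a *\<^sub>R A) *v x = a *\<^sub>R (A *v x)" for A :: "complex ^ 'n ^ 'm"
  by (simp add: matrix_vector_mult_def vec_eq_iff scaleR_sum_right)

lemma sum_matrix_vector: "(\<Sum>n\<in>A. M n) *v x = (\<Sum>n\<in>A. M n *v x)"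
  for M :: "'b \<Rightarrow> complex ^ 'n ^ 'm"
  by (induction A rule: infinite_finite_induct) (auto simp: matrix_vector_mult_add_rdistrib)

text \<open>The bound is deliberately asymmetric: only the norm of \<open>y\<close> is in the
  denominator, so with \<open>y\<close> fixed no lower bound on the norm of the varying vector
  \<open>x\<close> is required.\<close>

lemma norm_normalized_diff_le:
  fixes x y :: "'a::real_normed_vector"
  assumes "x \<noteq> 0" "y \<noteq> 0"
  shows "norm (x /\<^sub>R norm x - y /\<^sub>R norm y) \<le> 2 * norm (x - y) / norm y"
proof -
  have "x /\<^sub>R norm x - y /\<^sub>R norm y
      = (1 / norm y) *\<^sub>R ((x - y) + (norm y - norm x) *\<^sub>R (x /\<^sub>R norm x))"
  proof -
    have "(norm y - norm x) *\<^sub>R (x /\<^sub>R norm x) = norm y *\<^sub>R (x /\<^sub>R norm x) - x"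
      unfolding scaleR_diff_left using assms by simp
    then show ?thesis using assms by (simp add: scaleR_diff_right inverse_eq_divide)
  qed
  also have "norm \<dots> \<le> (1 / norm y) * (norm (x - y) + \<bar>norm y - norm x\<bar>)"
  proof -
    have "norm (x /\<^sub>R norm x) = 1" using assms by simp
    then have "norm ((norm y - norm x) *\<^sub>R (x /\<^sub>R norm x)) = \<bar>norm y - norm x\<bar>"
      by (simp only: norm_scaleR mult_1_right)
    then show ?thesis
      using norm_triangle_ineq[of "x - y" "(norm y - norm x) *\<^sub>R (x /\<^sub>R norm x)"]
      by (auto intro!: divide_right_mono)
  qed
  also have "\<dots> \<le> (1 / norm y) * (norm (x - y) + norm (x - y))"
    using norm_triangle_ineq3[of x y] by (intro mult_left_mono) (auto simp: abs_minus_commute)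
  finally show ?thesis by simp
qed

lemma finite_lower_bound:
  fixes g :: "'i::finite \<Rightarrow> real"
  assumes "\<And>i. 0 < g i"
  shows "\<exists>l>0. \<forall>i. l \<le> g i"
  using assms by (intro exI[of _ "Min (range g)"]) (auto simp: Min_gr_iff)

text \<open>The reciprocals converge, hence are bounded over all indices.\<close>

lemma positive_sequence_bounded_below:
  fixes X :: "nat \<Rightarrow> real"
  assumes "\<And>k. 0 < X k" "X \<longlonglongrightarrow> L" "0 < L"
  shows "\<exists>l>0. \<forall>k. l \<le> X k"
proof -
  have "(\<lambda>k. inverse (X k)) \<longlonglongrightarrow> inverse L" using assms by (intro tendsto_inverse) auto
  then obtain K where K: "K > 0" "\<And>k. norm (inverse (X k)) \<le> K"
    using convergent_imp_Bseq convergentI BseqE by metis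
  have "1 / K \<le> X k" for k
    using K(1) K(2)[of k] assms(1)[of k] by (simp add: field_simps)
  then show ?thesis using K by (intro exI[of _ "1 / K"]) auto
qed

lemma positive_vecD: "positive_vec x \<Longrightarrow> 0 < x $ i"
  by (simp only: positive_vec_def)

section \<open>The uplink covariance matrices and the MVDR directions\<close>

locale downlink =
  fixes H :: "('n::finite, 'j::finite, 'k::finite) channels"
    and w \<beta> \<sigma> :: "('j, 'k) powers" and P :: real
  assumes w: "positive_vec w" and \<beta>: "positive_vec \<beta>" and \<sigma>: "positive_vec \<sigma>" and P: "0 < P"
    and own_channel: "chan H m m \<noteq> 0"
begin

lemma pos_params: "0 < w $ m" "0 < \<beta> $ m" "0 < \<sigma> $ m"
  using w \<beta> \<sigma> by (auto intro: positive_vecD)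

text \<open>The Hermitian form of \<open>R q m\<close>. On unit vectors it is interference plus
  noise of user \<open>m\<close> in the uplink; the factor \<open>(norm u)\<^sup>2\<close> on the
  noise makes it homogeneous.\<close>

definition dual_form :: "('j, 'k) powers \<Rightarrow> 'j \<times> 'k \<Rightarrow> complex ^ 'n \<Rightarrow> real" where
  "dual_form q m u =
     (\<Sum>n\<in>UNIV - {m}. q $ n / CARD('n) * (cmod (herm_prod (chan H m n) u))\<^sup>2) + w $ m * (norm u)\<^sup>2"

abbreviation R :: "('j, 'k) powers \<Rightarrow> 'j \<times> 'k \<Rightarrow> complex ^ 'n ^ 'n" where
  "R q m \<equiv> mvdr_matrix H w q m"

definition mvdr_dir :: "('j, 'k) powers \<Rightarrow> 'j \<times> 'k \<Rightarrow> complex ^ 'n" where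
  "mvdr_dir q m = matrix_inv (R q m) *v chan H m m"

lemma mvdr_matrix_mult:
  "R q m *v x =
     (\<Sum>n\<in>UNIV - {m}. (q $ n / CARD('n)) *\<^sub>R (herm_prod (chan H m n) x *s chan H m n)) + (w $ m) *\<^sub>R x"
  by (simp add: mvdr_matrix_def matrix_vector_mult_add_rdistrib sum_matrix_vector
      scaleR_matrix_vector herm_outer_mult)

lemma herm_prod_mvdr_matrix:
  "herm_prod x (R q m *v y) =
     (\<Sum>n\<in>UNIV - {m}. of_real (q $ n / CARD('n)) *
        (cnj (herm_prod (chan H m n) x) * herm_prod (chan H m n) y)) + of_real (w $ m) * herm_prod x y"
  unfolding mvdr_matrix_mult herm_prod_add_right herm_prod_sum_right herm_prod_scaleR_right
    herm_prod_cmult_right herm_prod_cnj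
  by (simp add: mult_ac)

lemma mvdr_matrix_self_adjoint: "herm_prod (R q m *v x) y = herm_prod x (R q m *v y)"
proof -
  have "herm_prod (R q m *v x) y = cnj (herm_prod y (R q m *v x))" by (simp add: herm_prod_cnj)
  also have "\<dots> = herm_prod x (R q m *v y)"
    unfolding herm_prod_mvdr_matrix by (simp add: herm_prod_cnj mult_ac)
  finally show ?thesis .
qed

lemma dual_form_eq: "herm_prod x (R q m *v x) = of_real (dual_form q m x)"
proof -
  have "cnj z * z = of_real ((cmod z)\<^sup>2)" for z
    by (simp add: complex_norm_square mult.commute del: of_real_power)
  then show ?thesis
    unfolding herm_prod_mvdr_matrix dual_form_def herm_prod_self by simp
qed

lemma dual_form_lower:
  assumes "positive_vec q"
  shows "w $ m * (norm x)\<^sup>2 \<le> dual_form q m x"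
proof -
  have "0 \<le> q $ n" for n using positive_vecD[OF assms] by (simp add: less_imp_le)
  then show ?thesis unfolding dual_form_def by (simp add: sum_nonneg)
qed

lemma dual_form_pos:
  assumes "positive_vec q" "x \<noteq> 0"
  shows "0 < dual_form q m x"
  using dual_form_lower[OF assms(1), of m x] pos_params(1)[of m] assms(2)
  by (smt (verit) mult_pos_pos zero_less_norm_iff zero_less_power)

text \<open>The form of \<open>R q m\<close> is at least \<open>w $ m\<close> times the squared
  norm; Cauchy--Schwarz turns this into a bound on the image. It yields invertibility, and
  \<open>1 / w $ m\<close> as a bound on the inverse that is independent of
  \<open>q\<close>.\<close>

lemma mvdr_matrix_norm_lower:
  assumes "positive_vec q"
  shows "w $ m * norm x \<le> norm (R q m *v x)"
proof (cases "x = 0")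
  case False
  have "w $ m * (norm x)\<^sup>2 \<le> cmod (herm_prod x (R q m *v x))"
    using dual_form_lower[OF assms, of m x] unfolding dual_form_eq by simp
  also have "\<dots> \<le> norm x * norm (R q m *v x)" by (rule cmod_herm_prod_le)
  finally show ?thesis using False by (simp add: power2_eq_square)
qed simp

lemma mvdr_dir_eq:
  assumes "positive_vec q"
  shows "R q m *v mvdr_dir q m = chan H m m"
proof -
  have "x = 0" if "R q m *v x = 0" for x
    using mvdr_matrix_norm_lower[OF assms, of m x] pos_params(1)[of m] that
    by (simp add: mult_le_0_iff)
  then have "invertible (R q m)"
    unfolding invertible_left_inverse matrix_left_invertible_ker by blast
  then have "R q m ** matrix_inv (R q m) = mat 1"
    unfolding invertible_def matrix_inv_def by (rule someI2_ex) simp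
  then show ?thesis by (simp add: mvdr_dir_def matrix_vector_mul_assoc)
qed

lemma mvdr_dir_nonzero: "positive_vec q \<Longrightarrow> mvdr_dir q m \<noteq> 0"
  using mvdr_dir_eq[of q m] own_channel[of m] by auto

lemma mvdr_nth: "mvdr H w q $ m = mvdr_dir q m /\<^sub>R norm (mvdr_dir q m)"
  by (simp add: mvdr_def mvdr_dir_def Let_def)

lemma unit_beams_mvdr: "positive_vec q \<Longrightarrow> unit_beams (mvdr H w q)"
  using mvdr_dir_nonzero by (simp add: unit_beams_def mvdr_nth)

text \<open>For \<open>v\<close> with \<open>R q m *v v\<close> equal to the own channel, the
  response of that channel to \<open>v\<close> is the form at \<open>v\<close>; in particular it is
  real and positive.\<close>

lemma signal_mvdr_dir:
  assumes "positive_vec q"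
  shows "herm_prod (chan H m m) (mvdr_dir q m) = of_real (dual_form q m (mvdr_dir q m))"
  using dual_form_eq[of "mvdr_dir q m" q m] mvdr_dir_eq[OF assms, of m]
    mvdr_matrix_self_adjoint[of q m "mvdr_dir q m" "mvdr_dir q m"] by simp

text \<open>Cauchy--Schwarz for the form of \<open>R q m\<close>, from nonnegativity of the form at \<open>u - z v\<close>.\<close>

lemma signal_le_dual_form:
  assumes "positive_vec q"
  shows "(cmod (herm_prod (chan H m m) u))\<^sup>2 \<le> dual_form q m (mvdr_dir q m) * dual_form q m u"
proof -
  define v where "v = mvdr_dir q m"
  define D where "D = dual_form q m v"
  define a where "a = herm_prod (chan H m m) u"
  \<comment> \<open>The coefficient of the projection of \<open>u\<close> onto \<open>v\<close> in
    the inner product given by \<open>R q m\<close>; it minimises the form at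
    \<open>u - z *s v\<close>.\<close>
  define z where "z = a / of_real D"
  have D: "0 < D" unfolding D_def v_def using assms mvdr_dir_nonzero dual_form_pos by blast
  have Rv: "R q m *v v = chan H m m" unfolding v_def using assms by (rule mvdr_dir_eq)
  have vv: "herm_prod v (chan H m m) = of_real D" using dual_form_eq[of v q m] by (simp add: Rv D_def)
  have vu: "herm_prod v (R q m *v u) = a"
    using mvdr_matrix_self_adjoint[of q m v u] by (simp add: Rv a_def)
  have uv: "herm_prod u (chan H m m) = cnj a" by (simp add: a_def herm_prod_cnj)
  have Ruzv: "R q m *v (u - z *s v) = R q m *v u - z *s chan H m m"
    by (simp add: matrix_vector_mult_diff_distrib vector_scalar_commute Rv)
  have "of_real (dual_form q m (u - z *s v)) =
      of_real (dual_form q m u) - z * cnj a - cnj z * a + cnj z * z * of_real D"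
    unfolding dual_form_eq[symmetric] Ruzv
    by (simp add: herm_prod_diff_left herm_prod_diff_right herm_prod_cmult_left
        herm_prod_cmult_right vv vu uv algebra_simps)
  also have "\<dots> = of_real (dual_form q m u) - a * cnj a / of_real D"
    using D by (simp add: z_def field_simps)
  also have "\<dots> = of_real (dual_form q m u - (cmod a)\<^sup>2 / D)"
    by (simp add: complex_norm_square del: of_real_power)
  finally have "dual_form q m (u - z *s v) = dual_form q m u - (cmod a)\<^sup>2 / D"
    by (simp only: of_real_eq_iff)
  moreover have "0 \<le> dual_form q m (u - z *s v)"
    using dual_form_lower[OF assms, of m "u - z *s v"] pos_params(1)[of m]
    by (smt (verit) mult_nonneg_nonneg zero_le_power2)
  ultimately have "(cmod a)\<^sup>2 / D \<le> dual_form q m u" by linarith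
  then show ?thesis using D by (simp add: divide_le_eq mult.commute D_def v_def a_def)
qed

text \<open>Resolvent identity: applying \<open>R q m\<close> to the difference of the two
  directions gives \<open>R z m - R q m\<close> applied to \<open>mvdr_dir z m\<close>. The inverse
  of \<open>R q m\<close> is bounded by \<open>1 / w $ m\<close>, and \<open>R\<close> is affine in
  the power.\<close>

lemma mvdr_dir_lipschitz:
  assumes "positive_vec q" "positive_vec z"
  shows "w $ m * norm (mvdr_dir q m - mvdr_dir z m) \<le>
    norm (q - z) * ((\<Sum>n\<in>UNIV - {m}. (norm (chan H m n))\<^sup>2) * norm (mvdr_dir z m))"
proof -
  let ?v = "mvdr_dir z m"
  have "R q m *v (mvdr_dir q m - ?v) = R z m *v ?v - R q m *v ?v"
    using assms by (simp add: matrix_vector_mult_diff_distrib mvdr_dir_eq)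
  also have "\<dots> = (\<Sum>n\<in>UNIV - {m}. ((z $ n - q $ n) / CARD('n)) *\<^sub>R (herm_prod (chan H m n) ?v *s chan H m n))"
    by (simp add: mvdr_matrix_mult sum_subtractf[symmetric] scaleR_diff_left[symmetric] diff_divide_distrib)
  also have "norm \<dots> \<le> (\<Sum>n\<in>UNIV - {m}. norm (q - z) * ((norm (chan H m n))\<^sup>2 * norm ?v))"
  proof (rule order_trans[OF norm_sum], rule sum_mono)
    fix n
    have "\<bar>z $ n - q $ n\<bar> \<le> norm (q - z)"
      by (metis abs_minus_commute component_le_norm_cart vector_minus_component)
    moreover have "\<bar>z $ n - q $ n\<bar> / CARD('n) \<le> \<bar>z $ n - q $ n\<bar> / 1"
      by (intro divide_left_mono) (auto simp: Suc_le_eq)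
    ultimately have 1: "\<bar>(z $ n - q $ n) / CARD('n)\<bar> \<le> norm (q - z)" by (simp add: abs_divide)
    have "norm (herm_prod (chan H m n) ?v *s chan H m n) \<le> (norm (chan H m n) * norm ?v) * norm (chan H m n)"
      unfolding norm_cmult_vec by (intro mult_right_mono cmod_herm_prod_le) simp
    then have 2: "norm (herm_prod (chan H m n) ?v *s chan H m n) \<le> (norm (chan H m n))\<^sup>2 * norm ?v"
      by (simp add: power2_eq_square mult_ac)
    show "norm (((z $ n - q $ n) / CARD('n)) *\<^sub>R (herm_prod (chan H m n) ?v *s chan H m n))
        \<le> norm (q - z) * ((norm (chan H m n))\<^sup>2 * norm ?v)"
      unfolding norm_scaleR using 1 2 by (intro mult_mono) auto
  qed
  finally show ?thesis
    using mvdr_matrix_norm_lower[OF assms(1), of m "mvdr_dir q m - ?v"]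
    by (simp add: sum_distrib_left sum_distrib_right)
qed

lemma mvdr_lipschitz:
  assumes "positive_vec z"
  shows "\<exists>L\<ge>0. \<forall>q. positive_vec q \<longrightarrow> norm (mvdr H w q - mvdr H w z) \<le> L * norm (q - z)"
proof -
  \<comment> \<open>The factor \<open>norm (mvdr_dir z m)\<close> in the estimate for the directions
    cancels against the denominator that comes from normalising, so it does not appear here.\<close>
  define c where "c m = 2 * (\<Sum>n\<in>UNIV - {m}. (norm (chan H m n))\<^sup>2) / w $ m" for m
  have "norm (mvdr H w q - mvdr H w z) \<le> (\<Sum>m\<in>UNIV. c m) * norm (q - z)" if q: "positive_vec q" for q
  proof -
    have "norm (mvdr H w q $ m - mvdr H w z $ m) \<le> c m * norm (q - z)" for m
    proof -
      have "norm (mvdr H w q $ m - mvdr H w z $ m)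
          \<le> 2 * norm (mvdr_dir q m - mvdr_dir z m) / norm (mvdr_dir z m)"
        unfolding mvdr_nth using q assms by (intro norm_normalized_diff_le mvdr_dir_nonzero)
      also have "\<dots> \<le> c m * norm (q - z)"
        using mvdr_dir_lipschitz[OF q assms, of m] pos_params(1)[of m] mvdr_dir_nonzero[OF assms, of m]
        by (simp add: c_def field_simps)
      finally show ?thesis .
    qed
    then have "(\<Sum>m\<in>UNIV. norm ((mvdr H w q - mvdr H w z) $ m)) \<le> (\<Sum>m\<in>UNIV. c m * norm (q - z))"
      by (intro sum_mono) simp
    moreover have "norm (mvdr H w q - mvdr H w z) \<le> (\<Sum>m\<in>UNIV. norm ((mvdr H w q - mvdr H w z) $ m))"
      unfolding norm_vec_def[of "mvdr H w q - mvdr H w z"] by (rule L2_set_le_sum) simp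
    ultimately show ?thesis by (simp add: sum_distrib_right)
  qed
  moreover have "0 \<le> (\<Sum>m\<in>UNIV. c m)"
    unfolding c_def using pos_params(1)
    by (intro sum_nonneg divide_nonneg_nonneg mult_nonneg_nonneg) (auto intro: less_imp_le)
  ultimately show ?thesis by blast
qed

end

section \<open>The interference maps\<close>

text \<open>Think of \<open>S\<close> as interference and \<open>d\<close> as noise. Then
  \<open>a * S + d = a * (S + d) - (a - 1) * d\<close>, and the last term is at least
  \<open>(a - 1) * \<epsilon> * (S + d)\<close>.\<close>

lemma affine_contraction_factor:
  assumes "S' \<le> a * S" "1 \<le> a" "\<epsilon> * (S + d) \<le> d" "0 \<le> (c::real)"
  shows "c * (S' + d) \<le> (a * (1 - \<epsilon>) + \<epsilon>) * (c * (S + d))"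
proof -
  have "(a - 1) * (\<epsilon> * (S + d)) \<le> (a - 1) * d" using assms by (intro mult_left_mono) auto
  then have "S' + d \<le> (a * (1 - \<epsilon>) + \<epsilon>) * (S + d)" using assms(1) by (simp add: algebra_simps)
  then have "c * (S' + d) \<le> c * ((a * (1 - \<epsilon>) + \<epsilon>) * (S + d))" using assms(4) by (rule mult_left_mono)
  then show ?thesis by (simp add: mult_ac)
qed

text \<open>The rate must not depend on the coefficients \<open>A\<close>, because in the dual map
  they come from beams that vary with the power.\<close>

lemma affine_contraction_rate:
  fixes c d :: "real ^ 'i::finite"
  assumes "positive_vec c" "positive_vec d" "0 < B" "0 \<le> K"
  obtains \<epsilon> where "0 < \<epsilon>" "\<epsilon> < 1"
    "\<And>y A m. positive_vec y \<Longrightarrow> c \<bullet> y \<le> B \<Longrightarrow> (\<And>n. 0 \<le> A n) \<Longrightarrow> (\<And>n. A n \<le> K) \<Longrightarrow>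
      \<epsilon> * ((\<Sum>n\<in>UNIV - {m}. y $ n * A n) + d $ m) \<le> d $ m"
proof -
  obtain l where l: "l > 0" "\<And>i. l \<le> d $ i"
    using finite_lower_bound[of "\<lambda>i. d $ i"] positive_vecD[OF assms(2)] by auto
  define S where "S = (\<Sum>n\<in>UNIV. B / c $ n * K)"
  have S: "0 \<le> S" unfolding S_def using assms(3,4) positive_vecD[OF assms(1)]
    by (intro sum_nonneg) (simp add: less_imp_le)
  \<comment> \<open>The share of \<open>d $ m\<close> in the sum is at least
    \<open>l / (S + l)\<close>; the added 1 keeps \<epsilon> below 1 even if
    \<open>S = 0\<close>.\<close>
  define \<epsilon> where "\<epsilon> = l / (S + l + 1)"
  have \<epsilon>: "0 < \<epsilon>" "\<epsilon> < 1" using S l by (auto simp: \<epsilon>_def)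
  have "\<epsilon> * ((\<Sum>n\<in>UNIV - {m}. y $ n * A n) + d $ m) \<le> d $ m"
    if y: "positive_vec y" "c \<bullet> y \<le> B" and A: "\<And>n. 0 \<le> A n" "\<And>n. A n \<le> K" for y A m
  proof -
    have y0: "0 \<le> y $ n" and yB: "y $ n \<le> B / c $ n" for n
      using positive_vecD[OF y(1), of n] component_le_inner[OF assms(1) y(1), of n]
        divide_right_mono[OF y(2), of "c $ n"] positive_vecD[OF assms(1), of n] by linarith+
    have "(\<Sum>n\<in>UNIV - {m}. y $ n * A n) \<le> (\<Sum>n\<in>UNIV. y $ n * A n)"
      using y0 A by (intro sum_mono2) auto
    also have "\<dots> \<le> S" unfolding S_def
      using A y0 yB by (intro sum_mono mult_mono) (auto intro: order_trans[OF y0 yB])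
    finally have "(\<Sum>n\<in>UNIV - {m}. y $ n * A n) \<le> S" .
    then have "l * (\<Sum>n\<in>UNIV - {m}. y $ n * A n) \<le> d $ m * (S + 1)"
      using l S by (intro mult_mono sum_nonneg mult_nonneg_nonneg y0 A) (auto intro: order_trans[OF less_imp_le[OF l(1)] l(2)])
    then have "l * ((\<Sum>n\<in>UNIV - {m}. y $ n * A n) + d $ m) \<le> d $ m * (S + l + 1)"
      by (simp add: distrib_left mult.commute)
    then have "l * ((\<Sum>n\<in>UNIV - {m}. y $ n * A n) + d $ m) / (S + l + 1) \<le> d $ m"
      using S l(1) by (simp add: pos_divide_le_eq)
    then show ?thesis by (simp add: \<epsilon>_def)
  qed
  then show ?thesis using that[of \<epsilon>] \<epsilon> by blast
qed

section \<open>Power control with given beamformers\<close>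

context downlink
begin

definition signal :: "('n, 'j, 'k) beams \<Rightarrow> 'j \<times> 'k \<Rightarrow> real" where
  "signal U m = (cmod (herm_prod (chan H m m) (U $ m)))\<^sup>2 / CARD('n)"

definition dual_den :: "('n, 'j, 'k) beams \<Rightarrow> ('j, 'k) powers \<Rightarrow> 'j \<times> 'k \<Rightarrow> real" where
  "dual_den U q m =
     (\<Sum>n\<in>UNIV - {m}. q $ n * ((cmod (herm_prod (chan H m n) (U $ m)))\<^sup>2 / CARD('n))) + w $ m"

definition primal_den :: "('n, 'j, 'k) beams \<Rightarrow> ('j, 'k) powers \<Rightarrow> 'j \<times> 'k \<Rightarrow> real" where
  "primal_den U p m =
     (\<Sum>n\<in>UNIV - {m}. p $ n * ((cmod (herm_prod (chan H n m) (U $ n)))\<^sup>2 / CARD('n))) + \<sigma> $ m"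

text \<open>The interference function of power control: the power user \<open>m\<close> needs to
  meet the target \<open>\<beta> $ m\<close> exactly while the other powers stay at
  \<open>q\<close>. An objective value of at least \<open>t > 0\<close> thus means
  \<open>dual_map U q \<le> q / t\<close>.\<close>

definition dual_map :: "('n, 'j, 'k) beams \<Rightarrow> ('j, 'k) powers \<Rightarrow> ('j, 'k) powers" where
  "dual_map U q = (\<chi> m. \<beta> $ m / signal U m * dual_den U q m)"

definition primal_map :: "('n, 'j, 'k) beams \<Rightarrow> ('j, 'k) powers \<Rightarrow> ('j, 'k) powers" where
  "primal_map U p = (\<chi> m. \<beta> $ m / signal U m * primal_den U p m)"

lemma sinr_dual_eq: "sinr_dual H w q U m = q $ m * signal U m / dual_den U q m"
  by (simp add: sinr_dual_def signal_def dual_den_def)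

lemma sinr_primal_eq: "sinr_primal H \<sigma> p U m = p $ m * signal U m / primal_den U p m"
  by (simp add: sinr_primal_def signal_def primal_den_def)

lemma dual_ratio_eq: "sinr_dual H w q U m / \<beta> $ m = q $ m / dual_map U q $ m"
  by (simp add: sinr_dual_eq dual_map_def)

lemma primal_ratio_eq: "sinr_primal H \<sigma> p U m / \<beta> $ m = p $ m / primal_map U p $ m"
  by (simp add: sinr_primal_eq primal_map_def)

lemma dual_update_eq:
  assumes "positive_vec q"
  shows "dual_update H w \<beta> \<sigma> P q U =
    (CARD('n) * P / (\<sigma> \<bullet> dual_map U q)) *\<^sub>R dual_map U q"
proof -
  have "(\<chi> m. \<beta> $ m / sinr_dual H w q U m * q $ m) = dual_map U q"
    using positive_vecD[OF assms] unfolding sinr_dual_eq dual_map_def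
    by (simp add: vec_eq_iff less_imp_neq[symmetric] del: split_paired_All)
  then show ?thesis by (simp add: dual_update_def normalize_power_def)
qed

lemma primal_update_eq:
  assumes "positive_vec p"
  shows "primal_update H w \<beta> \<sigma> P p U =
    (CARD('n) * P / (w \<bullet> primal_map U p)) *\<^sub>R primal_map U p"
proof -
  have "(\<chi> m. \<beta> $ m / sinr_primal H \<sigma> p U m * p $ m) = primal_map U p"
    using positive_vecD[OF assms] unfolding sinr_primal_eq primal_map_def
    by (simp add: vec_eq_iff less_imp_neq[symmetric] del: split_paired_All)
  then show ?thesis by (simp add: primal_update_def normalize_power_def)
qed

lemma signal_nonneg: "0 \<le> signal U m"
  by (simp add: signal_def)

lemma dual_den_ge:
  assumes "positive_vec q"
  shows "w $ m \<le> dual_den U q m"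
  unfolding dual_den_def using less_imp_le[OF positive_vecD[OF assms]] by (simp add: sum_nonneg)

lemma primal_den_ge:
  assumes "positive_vec p"
  shows "\<sigma> $ m \<le> primal_den U p m"
  unfolding primal_den_def using less_imp_le[OF positive_vecD[OF assms]] by (simp add: sum_nonneg)

lemma dual_den_pos: "positive_vec q \<Longrightarrow> 0 < dual_den U q m"
  using dual_den_ge pos_params by (meson less_le_trans)

lemma primal_den_pos: "positive_vec p \<Longrightarrow> 0 < primal_den U p m"
  using primal_den_ge pos_params by (meson less_le_trans)

lemma dual_form_den: "unit_beams U \<Longrightarrow> dual_form q m (U $ m) = dual_den U q m"
  by (simp add: dual_form_def dual_den_def unit_beams_def del: split_paired_All)

lemma signal_mvdr:
  assumes "positive_vec q"
  shows "signal (mvdr H w q) m = (dual_form q m (mvdr_dir q m) / norm (mvdr_dir q m))\<^sup>2 / CARD('n)"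
  by (simp add: signal_def mvdr_nth herm_prod_scaleR_right signal_mvdr_dir[OF assms] norm_mult
      norm_inverse divide_inverse power_mult_distrib mult_ac power_inverse)

lemma signal_mvdr_pos:
  assumes "positive_vec q"
  shows "0 < signal (mvdr H w q) m"
  unfolding signal_mvdr[OF assms]
  using dual_form_pos[OF assms mvdr_dir_nonzero[OF assms], of m m] mvdr_dir_nonzero[OF assms, of m]
  by simp

lemma dual_den_mvdr:
  assumes "positive_vec q"
  shows "dual_den (mvdr H w q) q m = dual_form q m (mvdr_dir q m) / (norm (mvdr_dir q m))\<^sup>2"
proof -
  have n: "norm (mvdr_dir q m) \<noteq> 0" using mvdr_dir_nonzero[OF assms] by simp
  show ?thesis
    using n unfolding dual_den_def dual_form_def add_divide_distrib sum_divide_distrib mvdr_nth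
    by (simp add: herm_prod_scaleR_right norm_mult norm_inverse power_mult_distrib
        divide_inverse mult_ac power_inverse)
qed

text \<open>By Cauchy--Schwarz the ratio of \<open>dual_den\<close> to \<open>signal\<close> is at
  least \<open>CARD('n) / D\<close> for every unit beam, and the MVDR beam attains this. Positivity
  of the signal excludes the default value 0 of a division by zero, which would make the right-hand
  side 0.\<close>

lemma dual_map_mvdr_le:
  assumes "positive_vec q" "unit_beams U" "0 < signal U m"
  shows "dual_map (mvdr H w q) q $ m \<le> dual_map U q $ m"
proof -
  define D where "D = dual_form q m (mvdr_dir q m)"
  define r where "r = norm (mvdr_dir q m)"
  have D: "0 < D" unfolding D_def using assms(1) mvdr_dir_nonzero dual_form_pos by blast
  have r: "0 < r" unfolding r_def using assms(1) mvdr_dir_nonzero by simp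
  have "signal U m * CARD('n) \<le> D * dual_den U q m"
    using signal_le_dual_form[OF assms(1), of m "U $ m"] dual_form_den[OF assms(2)]
    by (simp add: signal_def D_def)
  then have "CARD('n) / D \<le> dual_den U q m / signal U m"
    using D assms(3) by (simp add: field_simps)
  moreover have "dual_den (mvdr H w q) q m / signal (mvdr H w q) m = CARD('n) / D"
    unfolding signal_mvdr[OF assms(1)] dual_den_mvdr[OF assms(1)] D_def[symmetric] r_def[symmetric]
    using D r by (simp add: field_simps power2_eq_square)
  ultimately have "dual_den (mvdr H w q) q m / signal (mvdr H w q) m \<le> dual_den U q m / signal U m"
    by simp
  then have "\<beta> $ m * (dual_den (mvdr H w q) q m / signal (mvdr H w q) m)
      \<le> \<beta> $ m * (dual_den U q m / signal U m)"
    using less_imp_le[OF pos_params(2)] by (rule mult_left_mono)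
  then show ?thesis by (simp add: dual_map_def)
qed

lemma gain_le:
  assumes "unit_beams U"
  shows "(cmod (herm_prod h (U $ m)))\<^sup>2 / CARD('n) \<le> (norm h)\<^sup>2"
proof -
  have "cmod (herm_prod h (U $ m)) \<le> norm h"
    using cmod_herm_prod_le[of h "U $ m"] assms unfolding unit_beams_def by (metis mult_1_right)
  then have le: "(cmod (herm_prod h (U $ m)))\<^sup>2 \<le> (norm h)\<^sup>2" by (simp add: power_mono)
  have "(cmod (herm_prod h (U $ m)))\<^sup>2 / CARD('n) \<le> (cmod (herm_prod h (U $ m)))\<^sup>2 / 1"
    by (intro divide_left_mono) (auto simp: Suc_le_eq)
  then show ?thesis unfolding div_by_1 using le by (rule order_trans)
qed

definition channel_bound :: real where
  "channel_bound = (\<Sum>n\<in>UNIV. \<Sum>m\<in>UNIV. (norm (chan H n m))\<^sup>2)"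

lemma chan_le_bound: "(norm (chan H n m))\<^sup>2 \<le> channel_bound"
proof -
  have "(norm (chan H n m))\<^sup>2 \<le> (\<Sum>m\<in>UNIV. (norm (chan H n m))\<^sup>2)"
    by (intro member_le_sum) auto
  also have "\<dots> \<le> channel_bound" unfolding channel_bound_def
    by (intro member_le_sum[of n UNIV "\<lambda>n. \<Sum>m\<in>UNIV. (norm (chan H n m))\<^sup>2"]) (auto intro: sum_nonneg)
  finally show ?thesis .
qed

lemma channel_bound_nonneg: "0 \<le> channel_bound"
  unfolding channel_bound_def by (intro sum_nonneg) auto

lemma signal_le: "unit_beams U \<Longrightarrow> signal U m \<le> channel_bound"
  unfolding signal_def using gain_le chan_le_bound by (meson order_trans)

text \<open>Signals of unit beams are at most \<open>channel_bound\<close>, so the bound holds for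
  all beams at once; the added 1 in the proof makes the denominator positive.\<close>

lemma map_lower_bound:
  assumes "positive_vec d"
  obtains l where "0 < l" "\<And>U m x. unit_beams U \<Longrightarrow> 0 < signal U m \<Longrightarrow> d $ m \<le> x \<Longrightarrow>
      l \<le> \<beta> $ m / signal U m * x"
proof -
  obtain b where b: "b > 0" "\<And>m. b \<le> \<beta> $ m * d $ m"
    using finite_lower_bound[of "\<lambda>m. \<beta> $ m * d $ m"] pos_params(2) positive_vecD[OF assms] by auto
  have "b / (channel_bound + 1) \<le> \<beta> $ m / signal U m * x"
    if "unit_beams U" "0 < signal U m" "d $ m \<le> x" for U m x
  proof -
    have "b \<le> \<beta> $ m * x" using b(2)[of m] that(3) pos_params(2)[of m]
      by (meson less_imp_le mult_left_mono order_trans)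
    then have "b / (channel_bound + 1) \<le> \<beta> $ m * x / signal U m"
      using b(1) that(2) signal_le[OF that(1), of m] by (intro frac_le) auto
    then show ?thesis by simp
  qed
  moreover have "0 < b / (channel_bound + 1)" using b channel_bound_nonneg by simp
  ultimately show ?thesis using that by blast
qed

lemma dual_subhomogeneous:
  "\<exists>l \<epsilon>. subhomogeneous_map (\<lambda>q. dual_map (mvdr H w q) q) \<sigma> (CARD('n) * P) l \<epsilon>"
proof -
  obtain l where l: "0 < l" "\<And>U m x. unit_beams U \<Longrightarrow> 0 < signal U m \<Longrightarrow> w $ m \<le> x \<Longrightarrow>
      l \<le> \<beta> $ m / signal U m * x"
    using map_lower_bound[OF w] by blast
  have NP: "0 < CARD('n) * P" using P by simp
  obtain \<epsilon> where \<epsilon>: "0 < \<epsilon>" "\<epsilon> < 1"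
    "\<And>y A m. positive_vec y \<Longrightarrow> \<sigma> \<bullet> y \<le> CARD('n) * P \<Longrightarrow> (\<And>n. 0 \<le> A n) \<Longrightarrow>
      (\<And>n. A n \<le> channel_bound) \<Longrightarrow> \<epsilon> * ((\<Sum>n\<in>UNIV - {m}. y $ n * A n) + w $ m) \<le> w $ m"
    using affine_contraction_rate[OF \<sigma> w NP channel_bound_nonneg] by blast
  have "subhomogeneous_map (\<lambda>q. dual_map (mvdr H w q) q) \<sigma> (CARD('n) * P) l \<epsilon>"
  proof
    fix x :: "('j, 'k) powers" and i
    assume x: "positive_vec x"
    show "l \<le> dual_map (mvdr H w x) x $ i"
      unfolding dual_map_def
      using l(2)[OF unit_beams_mvdr[OF x] signal_mvdr_pos[OF x] dual_den_ge[OF x]] by simp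
  next
    fix x y :: "('j, 'k) powers" and a i
    assume x: "positive_vec x" and y: "positive_vec y" "\<sigma> \<bullet> y \<le> CARD('n) * P"
      and a: "1 \<le> a" and le: "\<And>i. x $ i \<le> a * y $ i"
    \<comment> \<open>The beams are frozen at those for \<open>y\<close>. With them the map is
      affine, so the contraction factor applies; at \<open>x\<close> they are at best suboptimal, so
      the affine value bounds the true one from above.\<close>
    let ?U = "mvdr H w y"
    have U: "unit_beams ?U" "0 < signal ?U i" using y unit_beams_mvdr signal_mvdr_pos by auto
    let ?A = "\<lambda>n. (cmod (herm_prod (chan H i n) (?U $ i)))\<^sup>2 / CARD('n)"
    have A: "0 \<le> ?A n" "?A n \<le> channel_bound" for n
      using order_trans[OF gain_le[OF U(1)] chan_le_bound] by auto
    have "(\<Sum>n\<in>UNIV - {i}. x $ n * ?A n) \<le> a * (\<Sum>n\<in>UNIV - {i}. y $ n * ?A n)"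
      unfolding sum_distrib_left mult.assoc[symmetric]
      using le A(1) by (intro sum_mono mult_right_mono) auto
    then have "\<beta> $ i / signal ?U i * dual_den ?U x i
        \<le> (a * (1 - \<epsilon>) + \<epsilon>) * (\<beta> $ i / signal ?U i * dual_den ?U y i)"
      unfolding dual_den_def
      using a \<epsilon>(3)[OF y A] U(2) pos_params(2)[of i]
      by (intro affine_contraction_factor) auto
    then show "dual_map (mvdr H w x) x $ i \<le> (a * (1 - \<epsilon>) + \<epsilon>) * dual_map ?U y $ i"
      using dual_map_mvdr_le[OF x U] by (simp add: dual_map_def)
  qed (use \<sigma> NP \<epsilon> l in auto)
  then show ?thesis by blast
qed

lemma primal_subhomogeneous:
  assumes U: "unit_beams U" "\<And>m. 0 < signal U m"
  shows "\<exists>l \<epsilon>. subhomogeneous_map (primal_map U) w (CARD('n) * P) l \<epsilon>"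
proof -
  obtain l where l: "0 < l" "\<And>U m x. unit_beams U \<Longrightarrow> 0 < signal U m \<Longrightarrow> \<sigma> $ m \<le> x \<Longrightarrow>
      l \<le> \<beta> $ m / signal U m * x"
    using map_lower_bound[OF \<sigma>] by blast
  have NP: "0 < CARD('n) * P" using P by simp
  obtain \<epsilon> where \<epsilon>: "0 < \<epsilon>" "\<epsilon> < 1"
    "\<And>y A m. positive_vec y \<Longrightarrow> w \<bullet> y \<le> CARD('n) * P \<Longrightarrow> (\<And>n. 0 \<le> A n) \<Longrightarrow>
      (\<And>n. A n \<le> channel_bound) \<Longrightarrow> \<epsilon> * ((\<Sum>n\<in>UNIV - {m}. y $ n * A n) + \<sigma> $ m) \<le> \<sigma> $ m"
    using affine_contraction_rate[OF w \<sigma> NP channel_bound_nonneg] by blast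
  have "subhomogeneous_map (primal_map U) w (CARD('n) * P) l \<epsilon>"
  proof
    fix x :: "('j, 'k) powers" and i
    assume x: "positive_vec x"
    show "l \<le> primal_map U x $ i"
      unfolding primal_map_def using l(2)[OF U primal_den_ge[OF x]] by simp
  next
    fix x y :: "('j, 'k) powers" and a i
    assume x: "positive_vec x" and y: "positive_vec y" "w \<bullet> y \<le> CARD('n) * P"
      and a: "1 \<le> a" and le: "\<And>i. x $ i \<le> a * y $ i"
    let ?A = "\<lambda>n. (cmod (herm_prod (chan H n i) (U $ n)))\<^sup>2 / CARD('n)"
    have A: "0 \<le> ?A n" "?A n \<le> channel_bound" for n
      using order_trans[OF gain_le[OF U(1)] chan_le_bound] by auto
    have "(\<Sum>n\<in>UNIV - {i}. x $ n * ?A n) \<le> a * (\<Sum>n\<in>UNIV - {i}. y $ n * ?A n)"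
      unfolding sum_distrib_left mult.assoc[symmetric]
      using le A(1) by (intro sum_mono mult_right_mono) auto
    then have "\<beta> $ i / signal U i * primal_den U x i
        \<le> (a * (1 - \<epsilon>) + \<epsilon>) * (\<beta> $ i / signal U i * primal_den U y i)"
      unfolding primal_den_def
      using a \<epsilon>(3)[OF y A] U(2)[of i] pos_params(2)[of i]
      by (intro affine_contraction_factor) auto
    then show "primal_map U x $ i \<le> (a * (1 - \<epsilon>) + \<epsilon>) * primal_map U y $ i"
      by (simp add: primal_map_def)
  qed (use w NP \<epsilon> l in auto)
  then show ?thesis by blast
qed

end

section \<open>Optimality and perturbation\<close>

lemma le_Min_range_iff:
  fixes f :: "'i::finite \<Rightarrow> real"
  shows "t \<le> (MIN i. f i) \<longleftrightarrow> (\<forall>i. t \<le> f i)"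
  by (subst Min_ge_iff) auto

lemma sum_offdiag_swap:
  fixes f :: "'i::finite \<Rightarrow> 'i \<Rightarrow> real"
  shows "(\<Sum>m\<in>UNIV. \<Sum>n\<in>UNIV - {m}. f m n) = (\<Sum>n\<in>UNIV. \<Sum>m\<in>UNIV - {n}. f m n)"
proof -
  have 1: "(\<Sum>n\<in>UNIV - {m}. g n) = (\<Sum>n\<in>UNIV. if n = m then 0 else g n)" for g :: "'i \<Rightarrow> real" and m
    by (rule sum.mono_neutral_cong_left) auto
  show ?thesis unfolding 1 by (subst sum.swap) (intro sum.cong refl, auto)
qed

lemma fourth_power_geometric:
  fixes x X :: real
  assumes "0 \<le> x" "x \<le> X"
  shows "(1 + x) ^ 4 - 1 \<le> x * (4 + 6 * X + 4 * X\<^sup>2 + X ^ 3)"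
proof -
  have "(1 + x) ^ 4 - 1 = x * (4 + 6 * x + 4 * x\<^sup>2 + x ^ 3)"
    by (simp add: power_numeral_reduce algebra_simps)
  also have "\<dots> \<le> x * (4 + 6 * X + 4 * X\<^sup>2 + X ^ 3)"
    using assms by (intro mult_left_mono add_mono power_mono) auto
  finally show ?thesis .
qed

text \<open>The initial data are feasible but otherwise arbitrary, so the estimates begin at index
  1; the enlarged constant absorbs index 0.\<close>

lemma converges_geometrically_Suc:
  assumes "converges_geometrically (\<lambda>k. x (Suc k)) l"
  shows "converges_geometrically x l"
proof -
  obtain C r where C: "C > 0" "r \<in> {0<..<1}" "\<And>k. norm (x (Suc k) - l) \<le> C * r ^ k"
    using assms unfolding converges_geometrically_def by blast
  define C' where "C' = C / r + norm (x 0 - l)"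
  have "0 < C'" unfolding C'_def using C by (intro add_pos_nonneg) auto
  moreover have "norm (x k - l) \<le> C' * r ^ k" for k
  proof (cases k)
    case 0
    then show ?thesis using C by (simp add: C'_def)
  next
    case (Suc j)
    have "norm (x k - l) \<le> C / r * r ^ k" using C Suc by simp
    also have "\<dots> \<le> C' * r ^ k" using C by (intro mult_right_mono) (auto simp: C'_def)
    finally show ?thesis .
  qed
  ultimately show ?thesis unfolding converges_geometrically_def using C(2) by blast
qed

lemma converges_geometrically_le:
  assumes "converges_geometrically x l" "0 \<le> L" "\<And>k. norm (y k - l') \<le> L * norm (x k - l)"
  shows "converges_geometrically y l'"
proof -
  obtain C r where C: "C > 0" "r \<in> {0<..<1}" "\<And>k. norm (x k - l) \<le> C * r ^ k"
    using assms unfolding converges_geometrically_def by blast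
  have "norm (y k - l') \<le> ((L + 1) * C) * r ^ k" for k
  proof -
    have "norm (y k - l') \<le> L * (C * r ^ k)"
      using assms(3)[of k] mult_left_mono[OF C(3) assms(2)] by (meson order_trans)
    also have "\<dots> \<le> (L + 1) * (C * r ^ k)" using C by (intro mult_right_mono) auto
    finally show ?thesis by (simp add: mult_ac)
  qed
  moreover have "0 < (L + 1) * C" using assms(2) C(1) by simp
  ultimately show ?thesis unfolding converges_geometrically_def using C(2) by blast
qed

lemma converges_geometrically_tendsto:
  assumes "converges_geometrically x l"
  shows "x \<longlonglongrightarrow> l"
proof -
  obtain C r where C: "C > 0" "r \<in> {0<..<1}" "\<And>k. norm (x k - l) \<le> C * r ^ k"
    using assms unfolding converges_geometrically_def by blast
  have "(\<lambda>k. C * r ^ k) \<longlonglongrightarrow> C * 0"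
    using C(2) by (intro tendsto_mult tendsto_const LIMSEQ_power_zero) auto
  then have "(\<lambda>k. x k - l) \<longlonglongrightarrow> 0"
    by (intro Lim_null_comparison[OF always_eventually[OF allI[OF C(3)]]]) simp
  then show ?thesis by (simp add: LIM_zero_iff)
qed

section \<open>Duality and optimality of the eigenvectors\<close>

context downlink
begin

lemma dual_objective_eq: "dual_objective H \<beta> w q U = (MIN m. q $ m / dual_map U q $ m)"
  by (simp add: dual_objective_def dual_ratio_eq)

lemma primal_objective_eq: "primal_objective H \<beta> \<sigma> p U = (MIN m. p $ m / primal_map U p $ m)"
  by (simp add: primal_objective_def primal_ratio_eq)

lemma feasible_iff: "feasible_power CARD('n) c P x \<longleftrightarrow> positive_vec x \<and> c \<bullet> x \<le> CARD('n) * P"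
  by (simp add: feasible_power_def field_simps)

lemma ratio_ge_imp:
  assumes "0 < t" "0 < x" "0 < d" "t \<le> x / (\<beta> $ m / signal U m * d)"
  shows "0 < signal U m" "\<beta> $ m / signal U m * d \<le> 1 / t * x"
proof -
  \<comment> \<open>A vanishing signal would make both divisions 0, contrary to
    \<open>0 < t\<close>: a positive objective value forces positive signals.\<close>
  have "signal U m \<noteq> 0" using assms by auto
  then show s: "0 < signal U m" using signal_nonneg[of U m] by simp
  then have "0 < \<beta> $ m / signal U m * d" using assms(3) pos_params(2)[of m] by simp
  then have "t * (\<beta> $ m / signal U m * d) \<le> x" using assms(4) pos_le_divide_eq by blast
  then show "\<beta> $ m / signal U m * d \<le> 1 / t * x"
    using assms(1) by (simp only: pos_le_divide_eq mult_1 times_divide_eq_left mult.commute[of _ t])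
qed

text \<open>The uplink gain matrix is the transpose of the downlink one, so both weighted
  interference terms are the same double sum. Only the noise terms differ, and they are precisely
  the weighted total powers of the two budgets.\<close>

lemma coupling:
  "(\<Sum>m\<in>UNIV. q $ m * primal_den U p m) - \<sigma> \<bullet> q = (\<Sum>m\<in>UNIV. p $ m * dual_den U q m) - w \<bullet> p"
proof -
  let ?G = "\<lambda>n m. (cmod (herm_prod (chan H n m) (U $ n)))\<^sup>2 / CARD('n)"
  have "(\<Sum>m\<in>UNIV. q $ m * primal_den U p m) =
      (\<Sum>m\<in>UNIV. \<Sum>n\<in>UNIV - {m}. q $ m * (p $ n * ?G n m)) + \<sigma> \<bullet> q"
    by (simp add: primal_den_def distrib_left sum.distrib sum_distrib_left inner_vec_def mult.commute)
  moreover have "(\<Sum>m\<in>UNIV. p $ m * dual_den U q m) =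
      (\<Sum>n\<in>UNIV. \<Sum>m\<in>UNIV - {n}. q $ m * (p $ n * ?G n m)) + w \<bullet> p"
    by (simp add: dual_den_def distrib_left sum.distrib sum_distrib_left inner_vec_def mult_ac)
  ultimately show ?thesis
    using sum_offdiag_swap[of "\<lambda>m n. q $ m * (p $ n * ?G n m)"] by linarith
qed

text \<open>A value \<open>t\<close> makes \<open>q\<close> a subeigenvector with factor
  \<open>1 / t\<close> for the beams \<open>U\<close>, and replacing these by the MVDR beams for
  \<open>q\<close> only lowers the map. Uniqueness of subeigenvectors then gives the value and the
  power together.\<close>

lemma dual_optimum:
  assumes z: "positive_vec z" "\<sigma> \<bullet> z = CARD('n) * P" "dual_map (mvdr H w z) z = \<nu> *\<^sub>R z" "0 < \<nu>"
    and q: "feasible_power CARD('n) \<sigma> P q" "unit_beams U" "1 / \<nu> \<le> dual_objective H \<beta> w q U"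
  shows "dual_objective H \<beta> w q U = 1 / \<nu> \<and> q = z"
proof -
  obtain l \<epsilon> where "subhomogeneous_map (\<lambda>q. dual_map (mvdr H w q) q) \<sigma> (CARD('n) * P) l \<epsilon>"
    using dual_subhomogeneous by blast
  then interpret D: subhomogeneous_map "\<lambda>q. dual_map (mvdr H w q) q" \<sigma> "CARD('n) * P" l \<epsilon> .
  define t where "t = dual_objective H \<beta> w q U"
  have t0: "0 < t" using q(3) z(4) unfolding t_def[symmetric] by (smt (verit) zero_less_divide_1_iff)
  then have t: "0 < t" "1 / t \<le> \<nu>" using q(3) z(4) unfolding t_def[symmetric]
    by (simp_all add: field_simps)
  have qp: "positive_vec q" "\<sigma> \<bullet> q \<le> CARD('n) * P" using q(1) by (auto simp: feasible_iff)
  have "dual_map (mvdr H w q) q $ m \<le> 1 / t * q $ m" for m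
  proof -
    have "t \<le> q $ m / dual_map U q $ m"
      using t_def[unfolded dual_objective_eq] le_Min_range_iff[of t "\<lambda>m. q $ m / dual_map U q $ m"] by simp
    then have r: "t \<le> q $ m / (\<beta> $ m / signal U m * dual_den U q m)" by (simp add: dual_map_def)
    note r = ratio_ge_imp[OF t(1) positive_vecD[OF qp(1)] dual_den_pos[OF qp(1)] r]
    have "dual_map (mvdr H w q) q $ m \<le> dual_map U q $ m"
      using dual_map_mvdr_le qp q(2) r(1) by blast
    also have "\<dots> \<le> 1 / t * q $ m" using r(2) by (simp add: dual_map_def)
    finally show ?thesis .
  qed
  then have "1 / t = \<nu> \<and> q = z"
    using t by (intro D.subeigenvector_unique z(1,2,3) qp) auto
  then show ?thesis unfolding t_def[symmetric] by auto
qed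

lemma primal_optimum:
  assumes U: "unit_beams U" "\<And>m. 0 < signal U m"
    and z: "positive_vec z" "w \<bullet> z = CARD('n) * P" "primal_map U z = \<nu> *\<^sub>R z" "0 < \<nu>"
    and p: "feasible_power CARD('n) w P p" "1 / \<nu> \<le> primal_objective H \<beta> \<sigma> p U"
  shows "p = z"
proof -
  obtain l \<epsilon> where "subhomogeneous_map (primal_map U) w (CARD('n) * P) l \<epsilon>"
    using primal_subhomogeneous[OF U] by blast
  then interpret D: subhomogeneous_map "primal_map U" w "CARD('n) * P" l \<epsilon> .
  have pp: "positive_vec p" "w \<bullet> p \<le> CARD('n) * P" using p(1) by (auto simp: feasible_iff)
  have "primal_map U p $ m \<le> \<nu> * p $ m" for m
  proof -
    have "1 / \<nu> \<le> p $ m / primal_map U p $ m"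
      using p(2)[unfolded primal_objective_eq le_Min_range_iff] by blast
    then have r: "1 / \<nu> \<le> p $ m / (\<beta> $ m / signal U m * primal_den U p m)"
      by (simp add: primal_map_def)
    have n: "0 < 1 / \<nu>" using z by simp
    show ?thesis
      using ratio_ge_imp(2)[OF n positive_vecD[OF pp(1)] primal_den_pos[OF pp(1)] r]
      by (simp add: primal_map_def)
  qed
  then show ?thesis
    using D.subeigenvector_unique[OF z(1,2,3) pp _ z(4)] by blast
qed

text \<open>
  Weak duality.  The dual SINR constraints at \<open>z\<close> hold for every \<open>U\<close> because the beamformers
  \<open>mvdr H w z\<close> are best for the power \<open>z\<close>; weighting them by \<open>p\<close>, and the primal constraints by \<open>z\<close>,
  makes the interference terms of the two systems equal.
\<close>

lemma primal_objective_le: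
  assumes z: "positive_vec z" "\<sigma> \<bullet> z = CARD('n) * P" "dual_map (mvdr H w z) z = \<nu> *\<^sub>R z" "0 < \<nu>"
    and p: "feasible_power CARD('n) w P p" "unit_beams U"
  shows "primal_objective H \<beta> \<sigma> p U \<le> 1 / \<nu>"
proof (cases "0 < primal_objective H \<beta> \<sigma> p U")
  case False
  then show ?thesis using z(4) by (smt (verit) divide_pos_pos)
next
  case True
  define t where "t = primal_objective H \<beta> \<sigma> p U"
  have t: "0 < t" using True by (simp add: t_def)
  have pp: "positive_vec p" "w \<bullet> p \<le> CARD('n) * P" using p(1) by (auto simp: feasible_iff)
  have "t * (z $ m * primal_den U p m) \<le> 1 / \<nu> * (p $ m * dual_den U z m)" for m
  proof -
    have "t \<le> p $ m / primal_map U p $ m"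
      using t_def[unfolded primal_objective_eq] le_Min_range_iff[of t "\<lambda>m. p $ m / primal_map U p $ m"] by simp
    then have r: "t \<le> p $ m / (\<beta> $ m / signal U m * primal_den U p m)" by (simp add: primal_map_def)
    note r = ratio_ge_imp[OF t positive_vecD[OF pp(1)] primal_den_pos[OF pp(1)] r]
    have "\<nu> * z $ m \<le> dual_map U z $ m"
      using dual_map_mvdr_le[OF z(1) p(2) r(1)] z(3) by simp
    then have 1: "\<nu> * z $ m \<le> \<beta> $ m / signal U m * dual_den U z m" by (simp add: dual_map_def)
    define k where "k = \<beta> $ m / signal U m"
    have k: "0 < k" unfolding k_def using r(1) pos_params(2)[of m] by simp
    have "k * primal_den U p m * (\<nu> * z $ m) \<le> (1 / t * p $ m) * (k * dual_den U z m)"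
    proof (rule mult_mono)
      show "k * primal_den U p m \<le> 1 / t * p $ m" using r(2) by (simp only: k_def)
      show "\<nu> * z $ m \<le> k * dual_den U z m" using 1 by (simp only: k_def)
      show "0 \<le> 1 / t * p $ m" "0 \<le> \<nu> * z $ m"
        using t z(4) positive_vecD[OF z(1), of m] positive_vecD[OF pp(1), of m] by simp_all
    qed
    then have "k * (primal_den U p m * (\<nu> * z $ m)) \<le> k * (1 / t * p $ m * dual_den U z m)"
      by (simp add: mult_ac)
    then have "primal_den U p m * (\<nu> * z $ m) \<le> 1 / t * p $ m * dual_den U z m"
      using k by (simp only: mult_le_cancel_left_pos)
    then show ?thesis using t z(4) by (simp add: field_simps)
  qed
  then have "(\<Sum>m\<in>UNIV. t * (z $ m * primal_den U p m)) \<le> (\<Sum>m\<in>UNIV. 1 / \<nu> * (p $ m * dual_den U z m))"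
    by (rule sum_mono)
  then have le: "t * (\<Sum>m\<in>UNIV. z $ m * primal_den U p m) \<le> 1 / \<nu> * (\<Sum>m\<in>UNIV. p $ m * dual_den U z m)"
    by (simp only: sum_distrib_left)
  have pos: "0 < (\<Sum>m\<in>UNIV. z $ m * primal_den U p m)"
    using positive_vecD[OF z(1)] primal_den_pos[OF pp(1)] by (intro sum_pos) auto
  \<comment> \<open>The noise terms are comparable because \<open>p\<close> obeys the budget that
    \<open>z\<close> exhausts:
    \<open>w \<bullet> p \<le> CARD('n) * P = \<sigma> \<bullet> z\<close>.\<close>
  have "(\<Sum>m\<in>UNIV. p $ m * dual_den U z m) \<le> (\<Sum>m\<in>UNIV. z $ m * primal_den U p m)"
    using coupling[of z U p] z(2) pp(2) by linarith
  then have "1 / \<nu> * (\<Sum>m\<in>UNIV. p $ m * dual_den U z m) \<le> 1 / \<nu> * (\<Sum>m\<in>UNIV. z $ m * primal_den U p m)"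
    using z(4) by (intro mult_left_mono) auto
  then have "t * (\<Sum>m\<in>UNIV. z $ m * primal_den U p m) \<le> 1 / \<nu> * (\<Sum>m\<in>UNIV. z $ m * primal_den U p m)"
    using le by linarith
  then show ?thesis using pos unfolding t_def[symmetric] by (simp only: mult_le_cancel_right_pos)
qed

text \<open>Weight each eigenvalue equation by the eigenvector of the other problem. Both sums are
  multiples of the same positive number \<open>X\<close>, and since both budgets are exhausted the
  noise terms in \<open>coupling\<close> cancel. This is strong duality.\<close>

lemma eigenvalues_equal:
  assumes U: "\<And>m. 0 < signal U m"
    and q: "positive_vec q" "\<sigma> \<bullet> q = CARD('n) * P" "dual_map U q = \<nu> *\<^sub>R q"
    and p: "positive_vec p" "w \<bullet> p = CARD('n) * P" "primal_map U p = \<mu> *\<^sub>R p"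
  shows "\<mu> = \<nu>"
proof -
  define k where "k m = \<beta> $ m / signal U m" for m
  have k: "0 < k m" for m unfolding k_def using U pos_params(2) by simp
  have eq: "k m * dual_den U q m = \<nu> * q $ m" "k m * primal_den U p m = \<mu> * p $ m" for m
    using q(3) p(3) unfolding dual_map_def primal_map_def k_def
    by (simp_all add: vec_eq_iff del: split_paired_All)
  define X where "X = (\<Sum>m\<in>UNIV. q $ m * p $ m / k m)"
  have X: "0 < X" unfolding X_def
    using positive_vecD[OF q(1)] positive_vecD[OF p(1)] k by (intro sum_pos) auto
  have "q $ m * primal_den U p m = \<mu> * (q $ m * p $ m / k m)" for m
    using eq(2)[of m] k[of m] by (simp add: field_simps)
  then have 1: "(\<Sum>m\<in>UNIV. q $ m * primal_den U p m) = \<mu> * X"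
    by (simp only: X_def sum_distrib_left)
  have "p $ m * dual_den U q m = \<nu> * (q $ m * p $ m / k m)" for m
    using eq(1)[of m] k[of m] by (simp add: field_simps)
  then have 2: "(\<Sum>m\<in>UNIV. p $ m * dual_den U q m) = \<nu> * X"
    by (simp only: X_def sum_distrib_left)
  have "\<mu> * X = \<nu> * X" using coupling[of q U p] 1 2 q(2) p(2) by linarith
  then show ?thesis using X by simp
qed

lemma dual_objective_eigen:
  assumes "positive_vec q" "dual_map U q = \<nu> *\<^sub>R q"
  shows "dual_objective H \<beta> w q U = 1 / \<nu>"
proof -
  have "q $ m / dual_map U q $ m = 1 / \<nu>" for m
    using assms(2) positive_vecD[OF assms(1), of m] by simp
  then show ?thesis unfolding dual_objective_eq by (simp add: image_constant_conv)
qed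

lemma primal_objective_eigen:
  assumes "positive_vec p" "primal_map U p = \<nu> *\<^sub>R p"
  shows "primal_objective H \<beta> \<sigma> p U = 1 / \<nu>"
proof -
  have "p $ m / primal_map U p $ m = 1 / \<nu>" for m
    using assms(2) positive_vecD[OF assms(1), of m] by simp
  then show ?thesis unfolding primal_objective_eq by (simp add: image_constant_conv)
qed

text \<open>The common eigenvalue makes both candidates attain the bound \<open>1 / \<nu>\<close>.
  Conversely, dual optimality determines the dual power, the MVDR equation then determines the beams
  including their phases, and primal optimality for these beams determines the primal power.\<close>

lemma optimal_solution_characterization:
  obtains qs ps \<nu> where
    "positive_vec qs" "\<sigma> \<bullet> qs = CARD('n) * P" "dual_map (mvdr H w qs) qs = \<nu> *\<^sub>R qs"
    "positive_vec ps" "w \<bullet> ps = CARD('n) * P" "primal_map (mvdr H w qs) ps = \<nu> *\<^sub>R ps" "0 < \<nu>"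
    "\<And>s. optimal_solution H w \<beta> \<sigma> P s \<longleftrightarrow> s = (qs, ps, mvdr H w qs)"
proof -
  obtain l \<epsilon> where "subhomogeneous_map (\<lambda>q. dual_map (mvdr H w q) q) \<sigma> (CARD('n) * P) l \<epsilon>"
    using dual_subhomogeneous by blast
  then interpret D: subhomogeneous_map "\<lambda>q. dual_map (mvdr H w q) q" \<sigma> "CARD('n) * P" l \<epsilon> .
  obtain qs \<nu> where q: "positive_vec qs" "\<sigma> \<bullet> qs = CARD('n) * P" "0 < \<nu>"
    "dual_map (mvdr H w qs) qs = \<nu> *\<^sub>R qs" using D.eigenvector_ex by blast
  let ?U = "mvdr H w qs"
  have U: "unit_beams ?U" "\<And>m. 0 < signal ?U m"
    using q(1) unit_beams_mvdr signal_mvdr_pos by auto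
  obtain l' \<epsilon>' where "subhomogeneous_map (primal_map ?U) w (CARD('n) * P) l' \<epsilon>'"
    using primal_subhomogeneous[OF U] by blast
  then interpret E: subhomogeneous_map "primal_map ?U" w "CARD('n) * P" l' \<epsilon>' .
  obtain ps \<mu> where p: "positive_vec ps" "w \<bullet> ps = CARD('n) * P" "primal_map ?U ps = \<mu> *\<^sub>R ps"
    using E.eigenvector_ex by blast
  have "\<mu> = \<nu>" by (rule eigenvalues_equal[OF U(2) q(1,2,4) p])
  then have p3: "primal_map ?U ps = \<nu> *\<^sub>R ps" using p(3) by simp
  have fq: "feasible_power CARD('n) \<sigma> P qs" using q by (simp add: feasible_iff)
  have fp: "feasible_power CARD('n) w P ps" using p by (simp add: feasible_iff)
  have vq: "dual_objective H \<beta> w qs ?U = 1 / \<nu>" using q by (intro dual_objective_eigen)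
  have vp: "primal_objective H \<beta> \<sigma> ps ?U = 1 / \<nu>" using p p3 by (intro primal_objective_eigen)
  have dual_le: "\<not> 1 / \<nu> < dual_objective H \<beta> w q' U'"
    if "feasible_power CARD('n) \<sigma> P q'" "unit_beams U'" for q' U'
    using dual_optimum[OF q(1,2,4,3) that] by auto
  have primal_le: "\<not> 1 / \<nu> < primal_objective H \<beta> \<sigma> p' U'"
    if "feasible_power CARD('n) w P p'" "unit_beams U'" for p' U'
    using primal_objective_le[OF q(1,2,4,3) that] by auto
  have opt: "optimal_solution H w \<beta> \<sigma> P (qs, ps, ?U)"
    unfolding optimal_solution_def dual_power_opt_def primal_power_opt_def solves_dual_def
      solves_primal_def is_arg_max_def
    using U(1) fq fp vq vp dual_le primal_le by auto
  moreover have "s = (qs, ps, ?U)" if "optimal_solution H w \<beta> \<sigma> P s" for s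
  proof -
    obtain q' p' U' where s: "s = (q', p', U')" by (cases s)
    have U': "U' = mvdr H w q'" and
      d: "feasible_power CARD('n) \<sigma> P q'" "unit_beams U'"
         "\<not> dual_objective H \<beta> w q' U' < dual_objective H \<beta> w qs ?U" and
      p': "feasible_power CARD('n) w P p'"
         "\<not> primal_objective H \<beta> \<sigma> p' U' < primal_objective H \<beta> \<sigma> ps U'"
      using that fq fp U(1) unfolding s optimal_solution_def dual_power_opt_def primal_power_opt_def
        solves_dual_def solves_primal_def is_arg_max_def by auto
    have q': "q' = qs"
      using dual_optimum[OF q(1,2,4,3) d(1,2)] d(3) vq by simp
    have "p' = ps"
      using primal_optimum[OF U p(1,2) p3 q(3) p'(1)] p'(2) vp by (simp add: U' q')
    then show ?thesis by (simp add: s q' U')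
  qed
  ultimately show ?thesis using that[OF q(1,2,4) p(1,2) p3 q(3)] by blast
qed

section \<open>Dependence of the primal map on the beamformers\<close>

lemma gain_diff_le:
  assumes "unit_beams U" "unit_beams V"
  shows "(cmod (herm_prod (chan H n m) (U $ n)))\<^sup>2 / CARD('n)
    \<le> (cmod (herm_prod (chan H n m) (V $ n)))\<^sup>2 / CARD('n) + 2 * channel_bound * norm (U - V)"
proof -
  let ?h = "chan H n m"
  let ?a = "cmod (herm_prod ?h (U $ n))" and ?b = "cmod (herm_prod ?h (V $ n))"
  have ab: "?a \<le> norm ?h" "?b \<le> norm ?h"
    using cmod_herm_prod_le[of ?h] assms unfolding unit_beams_def by (metis mult_1_right)+
  have "?a - ?b \<le> cmod (herm_prod ?h (U $ n) - herm_prod ?h (V $ n))" by (rule norm_triangle_ineq2)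
  also have "\<dots> = cmod (herm_prod ?h ((U - V) $ n))" by (simp add: herm_prod_diff_right)
  also have "\<dots> \<le> norm ?h * norm ((U - V) $ n)" by (rule cmod_herm_prod_le)
  also have "\<dots> \<le> norm ?h * norm (U - V)" by (intro mult_left_mono Finite_Cartesian_Product.norm_nth_le norm_ge_zero)
  finally have d: "?a - ?b \<le> norm ?h * norm (U - V)" .
  have "?a\<^sup>2 - ?b\<^sup>2 = (?a - ?b) * (?a + ?b)" by (simp add: power2_eq_square algebra_simps)
  also have "\<dots> \<le> (norm ?h * norm (U - V)) * (?a + ?b)" using d by (rule mult_right_mono) simp
  also have "\<dots> \<le> (norm ?h * norm (U - V)) * (2 * norm ?h)" using ab by (intro mult_left_mono) auto
  also have "\<dots> = 2 * (norm ?h)\<^sup>2 * norm (U - V)" by (simp add: power2_eq_square)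
  also have "\<dots> \<le> 2 * channel_bound * norm (U - V)"
    using chan_le_bound by (intro mult_right_mono) auto
  finally have "?a\<^sup>2 \<le> ?b\<^sup>2 + 2 * channel_bound * norm (U - V)" by linarith
  then have "?a\<^sup>2 / CARD('n) \<le> (?b\<^sup>2 + 2 * channel_bound * norm (U - V)) / CARD('n)"
    by (rule divide_right_mono) simp
  also have "\<dots> = ?b\<^sup>2 / CARD('n) + 2 * channel_bound * norm (U - V) / CARD('n)"
    by (rule add_divide_distrib)
  also have "2 * channel_bound * norm (U - V) / CARD('n) \<le> 2 * channel_bound * norm (U - V) / 1"
    using channel_bound_nonneg by (intro divide_left_mono) (auto simp: Suc_le_eq)
  finally show ?thesis by simp
qed

text \<open>One factor \<open>1 + K * norm (U - V)\<close> comes from the signal in the denominator,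
  the other from interference plus noise; hence the square.\<close>

lemma primal_map_perturbation:
  assumes "0 < g"
  obtains K where "0 \<le> K"
    "\<And>U V p m. unit_beams U \<Longrightarrow> unit_beams V \<Longrightarrow> g \<le> signal U m \<Longrightarrow> g \<le> signal V m \<Longrightarrow>
      positive_vec p \<Longrightarrow> w \<bullet> p = CARD('n) * P \<Longrightarrow>
      primal_map U p $ m \<le> (1 + K * norm (U - V))\<^sup>2 * primal_map V p $ m"
proof -
  obtain s where s: "s > 0" "\<And>m. s \<le> \<sigma> $ m"
    using finite_lower_bound[of "\<lambda>m. \<sigma> $ m"] pos_params(3) by auto
  define M where "M = 2 * channel_bound"
  define B where "B = (\<Sum>n\<in>UNIV. CARD('n) * P / w $ n)"
  \<comment> \<open>Gains change by at most \<open>M * norm (U - V)\<close>. Relative to a signal of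
    at least \<open>g\<close> this costs \<open>M / g\<close>; summed over powers of total at most
    \<open>B\<close>, relative to noise of at least \<open>s\<close>, it costs
    \<open>B * M / s\<close>.\<close>
  define K where "K = M / g + B * M / s"
  have M: "0 \<le> M" using channel_bound_nonneg by (simp add: M_def)
  have B: "0 \<le> B" unfolding B_def using P pos_params(1)
    by (intro sum_nonneg) (simp add: less_imp_le)
  have K1: "M / g \<le> K" "B * M / s \<le> K" unfolding K_def using M B s assms by auto
  have K0: "0 \<le> K" using K1(1) M assms by (meson divide_nonneg_pos order_trans)
  have "primal_map U p $ m \<le> (1 + K * norm (U - V))\<^sup>2 * primal_map V p $ m"
    if U: "unit_beams U" "unit_beams V" "g \<le> signal U m" "g \<le> signal V m"
      and p: "positive_vec p" "w \<bullet> p = CARD('n) * P" for U V p m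
  proof -
    let ?d = "norm (U - V)"
    let ?G = "\<lambda>U n. (cmod (herm_prod (chan H n m) (U $ n)))\<^sup>2 / CARD('n)"
    have "signal V m \<le> signal U m + M * ?d"
      using gain_diff_le[OF U(2,1), of m m] by (simp add: signal_def M_def norm_minus_commute)
    also have "M * ?d = M / g * ?d * g" using assms by simp
    also have "\<dots> \<le> K * ?d * signal U m"
      using K1(1) K0 U(3) assms M by (intro mult_mono mult_right_mono) auto
    finally have sV: "signal V m \<le> (1 + K * ?d) * signal U m" by (simp add: algebra_simps)
    have p0: "0 \<le> p $ n" and pB: "p $ n \<le> CARD('n) * P / w $ n" for n
      using positive_vecD[OF p(1), of n] component_le_inner[OF w p(1), of n] p(2) by auto
    have "(\<Sum>n\<in>UNIV - {m}. p $ n * ?G U n) \<le> (\<Sum>n\<in>UNIV - {m}. p $ n * (?G V n + M * ?d))"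
      unfolding M_def by (intro sum_mono mult_left_mono gain_diff_le U p0)
    also have "\<dots> = (\<Sum>n\<in>UNIV - {m}. p $ n * ?G V n) + (\<Sum>n\<in>UNIV - {m}. p $ n) * (M * ?d)"
      by (simp only: distrib_left sum.distrib sum_distrib_right)
    finally have "primal_den U p m \<le> primal_den V p m + (\<Sum>n\<in>UNIV - {m}. p $ n) * (M * ?d)"
      by (simp add: primal_den_def)
    also have "(\<Sum>n\<in>UNIV - {m}. p $ n) * (M * ?d) \<le> B * (M * ?d)"
    proof (rule mult_right_mono)
      have "(\<Sum>n\<in>UNIV - {m}. p $ n) \<le> (\<Sum>n\<in>UNIV. p $ n)" using p0 by (intro sum_mono2) auto
      also have "\<dots> \<le> B" unfolding B_def using pB by (intro sum_mono)
      finally show "(\<Sum>n\<in>UNIV - {m}. p $ n) \<le> B" .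
    qed (use M in simp)
    also have "B * (M * ?d) = B * M / s * ?d * s" using s by simp
    also have "\<dots> \<le> K * ?d * primal_den V p m"
      using K1(2) K0 s(1) order_trans[OF s(2) primal_den_ge[OF p(1)]] M B
      by (intro mult_mono mult_right_mono) auto
    finally have den: "primal_den U p m \<le> (1 + K * ?d) * primal_den V p m" by (simp add: algebra_simps)
    have k1: "0 < 1 + K * ?d" using K0 by (simp add: add_pos_nonneg)
    have sp: "0 < signal U m" "0 < signal V m" using U assms by auto
    have "primal_map U p $ m = \<beta> $ m * primal_den U p m / signal U m" by (simp add: primal_map_def)
    also have "\<dots> \<le> \<beta> $ m * ((1 + K * ?d) * primal_den V p m) / (signal V m / (1 + K * ?d))"
    proof (rule frac_le)
      show "\<beta> $ m * primal_den U p m \<le> \<beta> $ m * ((1 + K * ?d) * primal_den V p m)"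
        using den less_imp_le[OF pos_params(2)] by (rule mult_left_mono)
      show "0 \<le> \<beta> $ m * ((1 + K * ?d) * primal_den V p m)"
        using k1 pos_params(2)[of m] primal_den_pos[OF p(1), of V m] by simp
      show "0 < signal V m / (1 + K * ?d)" using k1 sp by simp
      show "signal V m / (1 + K * ?d) \<le> signal U m" using sV k1 by (simp add: pos_divide_le_eq mult.commute)
    qed
    also have "\<dots> = (1 + K * ?d)\<^sup>2 * primal_map V p $ m"
      using k1 by (simp add: primal_map_def power2_eq_square)
    finally show ?thesis .
  qed
  then show ?thesis using that K0 by blast
qed

text \<open>The squared factor works in both directions, and \<open>hilbert_near\<close> takes the
  product of the two factors; hence the fourth power.\<close>

lemma primal_map_near:
  assumes "0 < g"
  obtains K where "0 \<le> K"
    "\<And>U V p. unit_beams U \<Longrightarrow> unit_beams V \<Longrightarrow> (\<And>m. g \<le> signal U m) \<Longrightarrow> (\<And>m. g \<le> signal V m) \<Longrightarrow>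
      positive_vec p \<Longrightarrow> w \<bullet> p = CARD('n) * P \<Longrightarrow>
      hilbert_near ((1 + K * norm (U - V)) ^ 4 - 1) (primal_map U p) (primal_map V p)"
proof -
  obtain K where K: "0 \<le> K"
    "\<And>U V p m. unit_beams U \<Longrightarrow> unit_beams V \<Longrightarrow> g \<le> signal U m \<Longrightarrow> g \<le> signal V m \<Longrightarrow>
      positive_vec p \<Longrightarrow> w \<bullet> p = CARD('n) * P \<Longrightarrow>
      primal_map U p $ m \<le> (1 + K * norm (U - V))\<^sup>2 * primal_map V p $ m"
    using primal_map_perturbation[OF assms] by blast
  have "hilbert_near ((1 + K * norm (U - V)) ^ 4 - 1) (primal_map U p) (primal_map V p)"
    if U: "unit_beams U" "unit_beams V" "\<And>m. g \<le> signal U m" "\<And>m. g \<le> signal V m"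
      and p: "positive_vec p" "w \<bullet> p = CARD('n) * P" for U V p
  proof -
    let ?a = "(1 + K * norm (U - V))\<^sup>2"
    have "0 < 1 + K * norm (U - V)" using K(1) by (simp add: add_pos_nonneg)
    then have a: "0 < ?a" by simp
    have "primal_map U p $ i \<le> ?a * primal_map V p $ i" "primal_map V p $ i \<le> ?a * primal_map U p $ i" for i
      using K(2)[OF U(1,2) U(3)[of i] U(4)[of i] p] K(2)[OF U(2,1) U(4)[of i] U(3)[of i] p]
      by (auto simp: norm_minus_commute)
    moreover have "?a * ?a \<le> 1 + ((1 + K * norm (U - V)) ^ 4 - 1)"
      by (simp add: power_numeral_reduce)
    ultimately show ?thesis unfolding hilbert_near_def using a by blast
  qed
  then show ?thesis using that K(1) by blast
qed

end

section \<open>Convergence of the alternating iteration\<close>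

theorem theorem1:
  fixes H :: "'j::finite \<Rightarrow> 'j \<times> 'k::finite \<Rightarrow> complex ^ 'n::finite"
    and w \<beta> \<sigma> :: "real ^ ('j \<times> 'k)"
    and P :: real
    and q p :: "nat \<Rightarrow> real ^ ('j \<times> 'k)"
    and U :: "nat \<Rightarrow> complex ^ 'n ^ ('j \<times> 'k)"
  assumes "positive_vec w" and "positive_vec \<beta>" and "positive_vec \<sigma>" and "P > 0"
    and "feasible_power CARD('n) \<sigma> P (q 0)"
    and "feasible_power CARD('n) w P (p 0)"
    and "unit_beams (U 0)"
    and "\<And>k. q (Suc k) = dual_update H w \<beta> \<sigma> P (q k) (U k)"
    and "\<And>k. U (Suc k) = mvdr H w (q (Suc k))"
    and "\<And>k. p (Suc k) = primal_update H w \<beta> \<sigma> P (p k) (U (Suc k))"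
    and "\<And>k m n. gain H (U k) m n > 0"
    and "\<And>qs ps Us m n. optimal_solution H w \<beta> \<sigma> P (qs, ps, Us) \<Longrightarrow> gain H Us m n > 0"
  shows "(\<exists>!s. optimal_solution H w \<beta> \<sigma> P s) \<and>
    (\<forall>qs ps Us. optimal_solution H w \<beta> \<sigma> P (qs, ps, Us) \<longrightarrow>
       converges_geometrically q qs \<and> converges_geometrically p ps \<and> converges_geometrically U Us)"
proof -
  note q_step = assms(8) and U_step = assms(9) and p_step = assms(10) and gain_pos = assms(11)
  have "chan H m m \<noteq> 0" for m
    using gain_pos[of 0 m m] by (auto simp: gain_def herm_prod_def)
  then interpret downlink H w \<beta> \<sigma> P
    using assms(1-4) by unfold_locales
  let ?B = "CARD('n) * P"
  have B: "0 < ?B" using assms(4) by simp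
  have signal_pos: "0 < signal (U k) m" for k m
    using gain_pos[of k m m] by (simp add: gain_def signal_def)

  have dual_map_pos: "positive_vec (dual_map V x)" if "positive_vec x" "\<And>m. 0 < signal V m" for V x
    using dual_den_pos[OF that(1)] pos_params(2) that(2)
    by (simp add: positive_vec_def dual_map_def del: split_paired_All)
  have primal_map_pos: "positive_vec (primal_map V x)" if "positive_vec x" "\<And>m. 0 < signal V m" for V x
    using primal_den_pos[OF that(1)] pos_params(2) that(2)
    by (simp add: positive_vec_def primal_map_def del: split_paired_All)
  have normalized: "positive_vec ((?B / (c \<bullet> y)) *\<^sub>R y) \<and> c \<bullet> ((?B / (c \<bullet> y)) *\<^sub>R y) = ?B"
    if "positive_vec c" "positive_vec y" for c y :: "real ^ ('j \<times> 'k)"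
  proof -
    have "0 < c \<bullet> y" by (rule inner_positive_vec[OF that])
    then have s: "0 < ?B / (c \<bullet> y)" and "c \<bullet> ((?B / (c \<bullet> y)) *\<^sub>R y) = ?B"
      using B by simp_all
    moreover have "0 < ((?B / (c \<bullet> y)) *\<^sub>R y) $ i" for i
      unfolding vector_scaleR_component real_scaleR_def
      using s positive_vecD[OF that(2)] by (rule mult_pos_pos)
    ultimately show ?thesis by (simp only: positive_vec_def simp_thms)
  qed
  have qpos: "positive_vec (q k)" for k
  proof (induction k)
    case 0
    show ?case using assms(5) by (simp add: feasible_power_def)
  next
    case (Suc k)
    show ?case unfolding q_step dual_update_eq[OF Suc]
      using normalized[OF \<sigma> dual_map_pos[OF Suc signal_pos]] by blast
  qed
  have ppos: "positive_vec (p k)" for k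
  proof (induction k)
    case 0
    show ?case using assms(6) by (simp add: feasible_power_def)
  next
    case (Suc k)
    show ?case unfolding p_step primal_update_eq[OF Suc]
      using normalized[OF w primal_map_pos[OF Suc signal_pos]] by blast
  qed
  have qB: "\<sigma> \<bullet> q (Suc k) = ?B" for k
    unfolding q_step dual_update_eq[OF qpos]
    using normalized[OF \<sigma> dual_map_pos[OF qpos signal_pos]] by blast
  have pB: "w \<bullet> p (Suc k) = ?B" for k
    unfolding p_step primal_update_eq[OF ppos]
    using normalized[OF w primal_map_pos[OF ppos signal_pos]] by blast

  obtain qs ps \<nu> where
    qs: "positive_vec qs" "\<sigma> \<bullet> qs = ?B" "dual_map (mvdr H w qs) qs = \<nu> *\<^sub>R qs" and
    ps: "positive_vec ps" "w \<bullet> ps = ?B" "primal_map (mvdr H w qs) ps = \<nu> *\<^sub>R ps" and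
    \<nu>: "0 < \<nu>" and
    opt: "\<And>s. optimal_solution H w \<beta> \<sigma> P s \<longleftrightarrow> s = (qs, ps, mvdr H w qs)"
    by (rule optimal_solution_characterization) (rule that)
  let ?U = "mvdr H w qs"
  have U: "unit_beams ?U" "\<And>m. 0 < signal ?U m"
    using qs(1) unit_beams_mvdr signal_mvdr_pos by auto

  obtain l \<epsilon> where "subhomogeneous_map (\<lambda>q. dual_map (mvdr H w q) q) \<sigma> ?B l \<epsilon>"
    using dual_subhomogeneous by blast
  then interpret D: subhomogeneous_map "\<lambda>q. dual_map (mvdr H w q) q" \<sigma> ?B l \<epsilon> .
  \<comment> \<open>From index 1 on the beams are the MVDR beams for the current power, and the
    power exhausts the budget, so the iteration is exactly \<open>D.T\<close>. The perturbation is 0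
    and the rate \<open>1 / 2\<close> assigned to it is arbitrary.\<close>
  have "converges_geometrically (\<lambda>k. q (Suc k)) qs"
  proof (rule D.perturbed_iteration_converges)
    show "q (Suc (Suc k)) = (?B / (\<sigma> \<bullet> dual_map (mvdr H w (q (Suc k))) (q (Suc k)))) *\<^sub>R
        dual_map (mvdr H w (q (Suc k))) (q (Suc k))" for k
      unfolding q_step[of "Suc k"] U_step dual_update_eq[OF qpos] ..
    show "hilbert_near 0 (dual_map (mvdr H w y) y) (dual_map (mvdr H w y) y)" for y
      unfolding hilbert_near_def by (intro exI[of _ 1]) simp
    show "D.T qs = qs" unfolding D.T_def qs(3) using \<nu> assms(4) qs(2) by simp
    show "1 / 2 \<in> {0<..<1::real}" by simp
    show "0 \<le> 0 * (1 / 2 :: real) ^ k" for k :: nat by simp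
  qed (use qpos qB qs D.positive_f in \<open>auto intro: order_refl\<close>)
  then have q_conv: "converges_geometrically q qs" by (rule converges_geometrically_Suc)

  obtain L where L: "0 \<le> L" "\<And>q. positive_vec q \<Longrightarrow> norm (mvdr H w q - ?U) \<le> L * norm (q - qs)"
    using mvdr_lipschitz[OF qs(1)] by blast
  have US: "converges_geometrically (\<lambda>k. U (Suc k)) ?U"
    unfolding U_step using L(2)[OF qpos]
    by (rule converges_geometrically_le[OF \<open>converges_geometrically (\<lambda>k. q (Suc k)) qs\<close> L(1)])
  then have U_conv: "converges_geometrically U ?U" by (rule converges_geometrically_Suc)

  have unitU: "unit_beams (U k)" for k
    by (cases k) (use assms(7) U_step unit_beams_mvdr[OF qpos] in auto)
  \<comment> \<open>The perturbation estimate needs signals bounded below along the whole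
    trajectory. Each is positive, and they converge to the signal of the limiting beams, which is
    positive too.\<close>
  have "\<exists>g>0. \<forall>k. g \<le> signal (U k) m" for m
  proof (rule positive_sequence_bounded_below[OF signal_pos _ U(2)])
    show "(\<lambda>k. signal (U k) m) \<longlonglongrightarrow> signal ?U m"
      unfolding signal_def herm_prod_def
      by (intro tendsto_intros converges_geometrically_tendsto[OF U_conv]) simp
  qed
  then obtain g where g: "\<And>m. 0 < g m" "\<And>m k. g m \<le> signal (U k) m" by metis
  have "\<And>m. 0 < min (g m) (signal ?U m)" using g U by simp
  then obtain g0 where g0: "0 < g0" "\<And>m. g0 \<le> min (g m) (signal ?U m)"
    using finite_lower_bound[of "\<lambda>m. min (g m) (signal ?U m)"] by blast
  obtain K where K: "0 \<le> K"
    "\<And>U V p. unit_beams U \<Longrightarrow> unit_beams V \<Longrightarrow> (\<And>m. g0 \<le> signal U m) \<Longrightarrow> (\<And>m. g0 \<le> signal V m) \<Longrightarrow>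
      positive_vec p \<Longrightarrow> w \<bullet> p = ?B \<Longrightarrow>
      hilbert_near ((1 + K * norm (U - V)) ^ 4 - 1) (primal_map U p) (primal_map V p)"
    using primal_map_near[OF g0(1)] by blast
  obtain C r where C: "C > 0" "r \<in> {0<..<1}" "\<And>k. norm (U k - ?U) \<le> C * r ^ k"
    using U_conv unfolding converges_geometrically_def by blast
  \<comment> \<open>The distance of \<open>U k\<close> from its limit is replaced by its geometric
    bound. As \<open>r ^ k \<le> 1\<close>, the fourth power is then at most linear in
    \<open>r ^ k\<close>, with \<open>K * C\<close> as the bound \<open>X\<close>.\<close>
  define d where "d k = (1 + K * (C * r ^ k)) ^ 4 - 1" for k
  have KC: "0 \<le> K * (C * r ^ k)" for k using K C by simp
  have d0: "0 \<le> d k" for k using KC[of k] by (simp add: d_def)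
  have dC: "d k \<le> (K * C * (4 + 6 * (K * C) + 4 * (K * C)\<^sup>2 + (K * C) ^ 3)) * r ^ k" for k
  proof -
    have "r ^ k \<le> 1" using C by (simp add: power_le_one)
    then have "K * (C * r ^ k) \<le> K * (C * 1)" using K C by (intro mult_left_mono) auto
    then have "d k \<le> K * (C * r ^ k) * (4 + 6 * (K * C) + 4 * (K * C)\<^sup>2 + (K * C) ^ 3)"
      unfolding d_def using KC[of k] by (intro fourth_power_geometric) auto
    then show ?thesis by (simp add: mult_ac)
  qed
  have near: "hilbert_near (d k) (primal_map (U k) y) (primal_map ?U y)"
    if "positive_vec y" "w \<bullet> y = ?B" for k y
  proof (rule hilbert_near_mono)
    show "hilbert_near ((1 + K * norm (U k - ?U)) ^ 4 - 1) (primal_map (U k) y) (primal_map ?U y)"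
    proof (rule K(2)[OF unitU U(1) _ _ that])
      show "g0 \<le> signal (U k) m" "g0 \<le> signal ?U m" for m
        using g0(2)[of m] g(2)[of m k] by auto
    qed
    show "(1 + K * norm (U k - ?U)) ^ 4 - 1 \<le> d k"
      unfolding d_def using K(1) C(3)
      by (intro diff_right_mono power_mono add_left_mono mult_left_mono) auto
  qed
  obtain l' \<epsilon>' where "subhomogeneous_map (primal_map ?U) w ?B l' \<epsilon>'"
    using primal_subhomogeneous[OF U] by blast
  then interpret E: subhomogeneous_map "primal_map ?U" w ?B l' \<epsilon>' .
  \<comment> \<open>The update to \<open>p (Suc (Suc k))\<close> already uses the beams of index
    \<open>Suc (Suc k)\<close>. The sequence starts at index 1, where the budget is exhausted, so
    the perturbation is shifted by two; this is the factor \<open>r\<^sup>2\<close> below.\<close>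
  have "converges_geometrically (\<lambda>k. p (Suc k)) ps"
  proof (rule E.perturbed_iteration_converges)
    show "p (Suc (Suc k)) = (?B / (w \<bullet> primal_map (U (Suc (Suc k))) (p (Suc k)))) *\<^sub>R
        primal_map (U (Suc (Suc k))) (p (Suc k))" for k
      unfolding p_step[of "Suc k"] primal_update_eq[OF ppos] ..
    show "hilbert_near (d (Suc (Suc k))) (primal_map (U (Suc (Suc k))) y) (primal_map ?U y)"
      if "positive_vec y" "w \<bullet> y = ?B" for k y using near that by blast
    show "d (Suc (Suc k)) \<le> (K * C * (4 + 6 * (K * C) + 4 * (K * C)\<^sup>2 + (K * C) ^ 3) * r\<^sup>2) * r ^ k" for k
      using dC[of "Suc (Suc k)"] by (simp add: power2_eq_square mult_ac)
    show "E.T ps = ps" unfolding E.T_def ps(3) using \<nu> assms(4) ps(2) by simp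
    show "positive_vec (primal_map (U (Suc (Suc k))) y)" if "positive_vec y" for k y
      using primal_map_pos that signal_pos by blast
  qed (use ppos pB ps C(2) d0 in auto)
  then have p_conv: "converges_geometrically p ps" by (rule converges_geometrically_Suc)
  show ?thesis using q_conv p_conv U_conv by (auto simp: opt)
qed

end
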